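(* Let $g:\mathbb{R}^d\to\mathbb{R}^d$ and suppose that $h(x):=x-g(x)$ satisfies Assumption (H) stated in the context, with associated $x^*$ and constants $\hat\rho,\hat\kappa,\mu,L>0$. Consider Process I and Process II described in the context (both for Type-I or both for Type-II), and let $k$ be such that $m_{k+1}\ge2$. Assume that there are positive constants $\eta_0,\tau_0$ such that $\|h(x_j)\|_2\le\eta_0\|h(x_0)\|_2$ for $0\le j\le k+1$ and $|1-\Gamma_j^{(m_j)}|\ge\tau_0$ for $1\le j\le k$ (with $m_j\ge1$). Let $H_k,\hat H_k\in\mathbb{R}^{m_k\times m_k}$ be the upper Hessenberg matrices of Process I and Process II defined in the context, and let $\lambda$ be an eigenvalue of $H_k$. Then for $x_0$ sufficiently close to $x^*$, $$\min_{\hat\lambda\in\sigma(\hat H_k)}|\hat\lambda-\lambda|=\hat\kappa^{1/m_k}\,\mathcal{O}(\|x_{k-m_k}-x^*\|_2^{1/m_k}).$$ If, in addition, $\hat H_k$ is diagonalizable, i.e. there is a nonsingular matrix $M_k\in\mathbb{R}^{m_k\times m_k}$ such that $\hat H_k=M_k\hat D_kM_k^{-1}$ with $\hat D_k$ diagonal, then $$\min_{\hat\lambda\in\sigma(\hat H_k)}|\hat\lambda-\lambda|=\|M_k\|_2\|M_k^{-1}\|_2\,\hat\kappa\,\mathcal{O}(\|x_{k-m_k}-x^*\|_2).$$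
   Context: Notation. $\sigma(\cdot)$ is the spectrum; $\Delta x_k=x_{k+1}-x_k$, and similarly for other sequences; $\mathcal{S}(B)=(B+B^{\mathrm T})/2$. A (not necessarily symmetric) real square matrix $B$ is positive definite if all eigenvalues of $\mathcal{S}(B)$ are positive. Assumption (H) on $h(x)=x-g(x)$: (i) there exists $x^*$ with $h(x^* )=0$; (ii) $h$ is Lipschitz continuously differentiable in a neighbourhood of $x^*$; (iii) $h'(x^* )$ is positive definite. Consequently there are positive constants $\hat\rho,\hat\kappa,\mu,L$, which are fixed, such that for all $x\in\mathcal{B}_{\hat\rho}(x^* ):=\{z:\|z-x^*\|_2\le\hat\rho\}$ and all $y\in\mathbb{R}^d$: $\mu\|y\|_2\le\|h'(x)y\|_2\le L\|y\|_2$; $\mu\|y\|_2^2\le y^{\mathrm T}h'(x)y\le L\|y\|_2^2$; $\|h(x)-h'(x^* )(x-x^* )\|_2\le\frac12\hat\kappa\|x-x^*\|_2^2$. Restarted Anderson mixing. Inputs: $x_0\in\mathbb{R}^d$, mixing parameters $\beta_k$, an integer $m$ with $0<m\le d$, $\tau\in(0,1)$, $\eta>0$. Put $v_j:=p_j$ for the Type-I method and $v_j:=q_j$ for the Type-II method. Set $m_0=0$. For $k=0,1,\dots$ until convergence (i.e. as long as $r_k\ne0$): (1) $r_k:=g(x_k)-x_k$. If $m_k>m$ or $\|r_k\|_2>\eta\|r_{k-m_k}\|_2$, reset $m_k:=0$. (2) If $m_k>0$: set $p_k:=x_k-x_{k-1}$, $q_k:=r_k-r_{k-1}$; for $j=1,\dots,m_k-1$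 successively set $\zeta_k^{(j)}:=\frac{v_{k-m_k+j}^{\mathrm T}q_k}{v_{k-m_k+j}^{\mathrm T}q_{k-m_k+j}}$ and replace $p_k$ by $p_k-p_{k-m_k+j}\zeta_k^{(j)}$ and $q_k$ by $q_k-q_{k-m_k+j}\zeta_k^{(j)}$. Then, if $|v_k^{\mathrm T}q_k|<\tau|v_{k-m_k+1}^{\mathrm T}q_{k-m_k+1}|$, reset $m_k:=0$. (3) Set $\bar x_k:=x_k$, $\bar r_k:=r_k$; for $j=1,\dots,m_k$ successively set $\Gamma_k^{(j)}:=\frac{v_{k-m_k+j}^{\mathrm T}\bar r_k}{v_{k-m_k+j}^{\mathrm T}q_{k-m_k+j}}$ and replace $\bar x_k$ by $\bar x_k-p_{k-m_k+j}\Gamma_k^{(j)}$ and $\bar r_k$ by $\bar r_k-q_{k-m_k+j}\Gamma_k^{(j)}$. (4) $x_{k+1}:=\bar x_k+\beta_k\bar r_k$, $m_{k+1}:=m_k+1$ (possibly reset to $0$ in iteration $k+1$). $m_k$ denotes the final value in iteration $k$. Put $\zeta_k=(\zeta_k^{(1)},\dots,\zeta_k^{(m_k-1)})^{\mathrm T}$, $\Gamma_k=(\Gamma_k^{(1)},\dots,\Gamma_k^{(m_k)})^{\mathrm T}$. Process I: the restarted Anderson mixing method (Type-I or Type-II) applied to $x=g(x)$, with mixing parameters satisfying $\beta\le|\beta_k|\le\beta'$ for positive constants $\beta,\beta'$; it yields $\{x_k\}$. Process II: let $\hat h(x)=h'(x^* )(x-x^* )$, use the same $m_k,\beta_k$ as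 in Process I, and put $\hat r_k=-\hat h(\hat x_k)$. If $m_k=0$: $\hat x_k=x_k$ and $\hat x_{k+1}=\hat x_k+\beta_k\hat r_k$. If $m_k>0$: $\hat x_{k+1}=\hat x_k+\beta_k\hat r_k-(\hat P_k+\beta_k\hat Q_k)\hat\Gamma_k$, where $\hat P_k=(\hat p_{k-m_k+1},\dots,\hat p_k)$, $\hat Q_k=(\hat q_{k-m_k+1},\dots,\hat q_k)$, $\hat V_k=\hat P_k$ (Type-I) or $\hat V_k=\hat Q_k$ (Type-II), and $\hat\Gamma_k$ is such that $\hat r_k-\hat Q_k\hat\Gamma_k\perp\mathrm{range}(\hat V_k)$. Here $\hat p_k=\Delta\hat x_{k-1}$, $\hat q_k=\Delta\hat r_{k-1}$ if $m_k=1$; and $\hat p_k=\Delta\hat x_{k-1}-\hat P_{k-1}\hat\zeta_k$, $\hat q_k=\Delta\hat r_{k-1}-\hat Q_{k-1}\hat\zeta_k$ if $m_k\ge2$, with $\hat\zeta_k$ such that $\hat q_k\perp\mathrm{range}(\hat V_{k-1})$. Hessenberg matrix $H_k$ (defined when $m_{k+1}\ge2$). Let $\phi_k=\Gamma_k+\zeta_{k+1}\in\mathbb{R}^{m_k}$ and $\Gamma_k^{[m_k-1]}=(\Gamma_k^{(1)},\dots,\Gamma_k^{(m_k-1)})^{\mathrm T}$. Recursively, $\bar H_k\in\mathbb{R}^{(m_k+1)\times m_k}$ is $H_k\in\mathbb{R}^{m_k\times m_k}$ with the extra last row $h_k^{(m_k+1)}e_{m_k}^{\mathrm T}$ ($e_{m_k}$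 the last column of $I_{m_k}$), where $H_k=h_k$ if $m_k=1$, $H_k=(\bar H_{k-1},h_k)$ if $m_k\ge2$, and $$h_k=\frac{1}{1-\Gamma_k}\Bigl(\frac1{\beta_{k-1}}-\frac1{\beta_k}\phi_k\Bigr)\ (m_k=1),$$ $$h_k=\frac{1}{1-\Gamma_k^{(m_k)}}\Bigl(\frac1{\beta_{k-1}}\begin{pmatrix}\phi_{k-1}\\1\end{pmatrix}-\frac1{\beta_k}\phi_k-\bar H_{k-1}\bigl(\phi_{k-1}-\Gamma_k^{[m_k-1]}\bigr)\Bigr)\ (m_k\ge2),$$ $$h_k^{(m_k+1)}=-\frac{1}{\beta_k(1-\Gamma_k^{(m_k)})}\ (m_k\ge1).$$ $\hat H_k$ is defined by the same formulas with $\Gamma,\zeta$ replaced by $\hat\Gamma,\hat\zeta$ of Process II. Convention. "For $x_0$ sufficiently close to $x^*$ ... $\mathcal{O}(t)$" means: there are $\varepsilon>0$ and $C>0$, depending on $g$, $x^*$, the fixed constants and the parameters ($m,\tau,\eta,\beta,\beta',\eta_0,\tau_0$) but not on $x_0$ or $k$ (nor on $M_k$), such that whenever $\|x_0-x^*\|_2\le\varepsilon$ the assertion holds with $\mathcal{O}(t)$ bounded in absolute value by $Ct$. *)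

theory Defs
  imports "HOL-Analysis.Analysis" "Jordan_Normal_Form.Spectral_Radius"
begin

no_notation scalar_prod (infix "\<bullet>" 70)

text \<open>Vectors of \<open>\<real>\<^sup>d\<close> and \<open>d \<times> d\<close> matrices are \<open>real ^ 'd\<close> and \<open>real ^ 'd ^ 'd\<close>. The
  Hessenberg matrices have size \<open>m\<^sub>k\<close>, which varies with \<open>k\<close>, so they are \<open>real mat\<close>.\<close>

definition sym_part :: "real ^ 'd ^ 'd \<Rightarrow> real ^ 'd ^ 'd" where
  "sym_part B = (1 / 2) *\<^sub>R (B + transpose B)"

text \<open>The symmetric part has only real eigenvalues, so real eigenvectors suffice.\<close>

definition positive_definite :: "real ^ 'd ^ 'd \<Rightarrow> bool" where
  "positive_definite B \<longleftrightarrow> (\<forall>c v. v \<noteq> 0 \<and> sym_part B *v v = c *\<^sub>R v \<longrightarrow> 0 < c)"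

text \<open>Lipschitz continuity of the derivative is taken with respect to the norm of
  \<open>real ^ 'd ^ 'd\<close>, i.e. the Frobenius norm; another norm only changes the constant.\<close>

definition assumption_H :: "(real ^ 'd \<Rightarrow> real ^ 'd) \<Rightarrow> real ^ 'd \<Rightarrow> bool" where
  "assumption_H h xs \<longleftrightarrow>
     h xs = 0 \<and>
     (\<exists>U. open U \<and> xs \<in> U \<and> (\<forall>x\<in>U. h differentiable (at x)) \<and>
        (\<exists>K. K-lipschitz_on U (\<lambda>x. jacobian h (at x)))) \<and>
     positive_definite (jacobian h (at xs))"

definition assumption_H_constants ::
    "(real ^ 'd \<Rightarrow> real ^ 'd) \<Rightarrow> real ^ 'd \<Rightarrow> real \<Rightarrow> real \<Rightarrow> real \<Rightarrow> real \<Rightarrow> bool" where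
  "assumption_H_constants h xs \<rho> \<kappa> \<mu> L \<longleftrightarrow>
     0 < \<rho> \<and> 0 < \<kappa> \<and> 0 < \<mu> \<and> 0 < L \<and>
     (\<forall>x\<in>cball xs \<rho>.
        h differentiable (at x) \<and>
        (\<forall>y. \<mu> * norm y \<le> norm (jacobian h (at x) *v y) \<and>
             norm (jacobian h (at x) *v y) \<le> L * norm y \<and>
             \<mu> * (norm y)\<^sup>2 \<le> y \<bullet> (jacobian h (at x) *v y) \<and>
             y \<bullet> (jacobian h (at x) *v y) \<le> L * (norm y)\<^sup>2) \<and>
        norm (h x - jacobian h (at xs) *v (x - xs)) \<le> 1 / 2 * \<kappa> * (norm (x - xs))\<^sup>2)"

datatype am_type = Type_I | Type_II

text \<open>The data generated by a mixing process. \<open>am_m T k\<close> is the final value of \<open>m\<^sub>k\<close> in iteration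
  \<open>k\<close>; \<open>am_zeta T k j\<close> and \<open>am_Gamma T k j\<close> are \<open>\<zeta>\<^sub>k\<^sup>(\<^sup>j\<^sup>)\<close> and \<open>\<Gamma>\<^sub>k\<^sup>(\<^sup>j\<^sup>)\<close>, with \<open>j\<close> counted from 1.
  Entries that the process does not define are unconstrained.\<close>

record 'v am_run =
  am_x :: "nat \<Rightarrow> 'v"
  am_p :: "nat \<Rightarrow> 'v"
  am_q :: "nat \<Rightarrow> 'v"
  am_zeta :: "nat \<Rightarrow> nat \<Rightarrow> real"
  am_Gamma :: "nat \<Rightarrow> nat \<Rightarrow> real"
  am_m :: "nat \<Rightarrow> nat"

definition am_v :: "am_type \<Rightarrow> 'v am_run \<Rightarrow> nat \<Rightarrow> 'v" where
  "am_v tp T = (case tp of Type_I \<Rightarrow> am_p T | Type_II \<Rightarrow> am_q T)"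

text \<open>The coefficients \<open>c\<^sub>1, \<dots>, c\<^sub>n\<close> of the successive replacements of \<open>b\<close> by \<open>b - c\<^sub>j q\<^sub>s\<^sub>+\<^sub>j\<close>: the
  current vector before step \<open>j\<close> is \<open>b - (\<Sum>i<j. c\<^sub>i q\<^sub>s\<^sub>+\<^sub>i)\<close>.\<close>

definition successive_coeffs ::
    "(nat \<Rightarrow> 'v::real_inner) \<Rightarrow> (nat \<Rightarrow> 'v) \<Rightarrow> nat \<Rightarrow> nat \<Rightarrow> 'v \<Rightarrow> (nat \<Rightarrow> real) \<Rightarrow> bool" where
  "successive_coeffs v q s n b c \<longleftrightarrow>
     (\<forall>j\<in>{1..n}. c j = (v (s + j) \<bullet> (b - (\<Sum>i=1..<j. c i *\<^sub>R q (s + i)))) / (v (s + j) \<bullet> q (s + j)))"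

text \<open>Iteration \<open>k\<close> of restarted Anderson mixing. Here \<open>m0\<close> is the value of \<open>m\<^sub>k\<close> on entry, \<open>m1\<close> the
  value after the restart test of step (1), and \<open>am_m T k\<close> the one after that of step (2).\<close>

definition am_iteration ::
    "am_type \<Rightarrow> ('v::real_inner \<Rightarrow> 'v) \<Rightarrow> nat \<Rightarrow> real \<Rightarrow> real \<Rightarrow> (nat \<Rightarrow> real) \<Rightarrow> 'v am_run \<Rightarrow> nat \<Rightarrow> bool" where
  "am_iteration tp g m \<tau> \<eta> b T k \<longleftrightarrow>
    (let x = am_x T; p = am_p T; q = am_q T; v = am_v tp T; \<zeta> = am_zeta T; \<Gamma> = am_Gamma T;
         r = (\<lambda>j. g (x j) - x j);
         m0 = (if k = 0 then 0 else am_m T (k - 1) + 1);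
         m1 = (if m0 > m \<or> norm (r k) > \<eta> * norm (r (k - m0)) then 0 else m0);
         mk = am_m T k
     in
       (m1 > 0 \<longrightarrow>
          successive_coeffs v q (k - m1) (m1 - 1) (r k - r (k - 1)) (\<zeta> k) \<and>
          p k = x k - x (k - 1) - (\<Sum>j=1..m1-1. \<zeta> k j *\<^sub>R p (k - m1 + j)) \<and>
          q k = r k - r (k - 1) - (\<Sum>j=1..m1-1. \<zeta> k j *\<^sub>R q (k - m1 + j))) \<and>
       mk = (if m1 > 0 \<and> \<bar>v k \<bullet> q k\<bar> < \<tau> * \<bar>v (k - m1 + 1) \<bullet> q (k - m1 + 1)\<bar> then 0 else m1) \<and>
       successive_coeffs v q (k - mk) mk (r k) (\<Gamma> k) \<and>
       x (k + 1) = (x k - (\<Sum>j=1..mk. \<Gamma> k j *\<^sub>R p (k - mk + j))) +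
                   b k *\<^sub>R (r k - (\<Sum>j=1..mk. \<Gamma> k j *\<^sub>R q (k - mk + j))))"

text \<open>Process I, with iterations \<open>0, \<dots>, K\<close> all carried out (so no convergence before or at \<open>K\<close>).\<close>

definition restarted_AM ::
    "am_type \<Rightarrow> ('v::real_inner \<Rightarrow> 'v) \<Rightarrow> nat \<Rightarrow> real \<Rightarrow> real \<Rightarrow> (nat \<Rightarrow> real) \<Rightarrow> 'v am_run \<Rightarrow> nat \<Rightarrow> bool" where
  "restarted_AM tp g m \<tau> \<eta> b T K \<longleftrightarrow>
     (\<forall>k\<le>K. g (am_x T k) - am_x T k \<noteq> 0 \<and> am_iteration tp g m \<tau> \<eta> b T k)"

text \<open>Process II for the Jacobian \<open>A = h'(x\<^sup>*)\<close>, alongside the run \<open>T\<close> of Process I, for iterations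
  \<open>0, \<dots>, K\<close>. The update defines \<open>xh (k + 1)\<close> only if \<open>m\<^sub>k\<^sub>+\<^sub>1 > 0\<close>; otherwise iteration \<open>k + 1\<close>
  restarts from the iterate of Process I. For \<open>m\<^sub>k = 0\<close> the sum in the update is empty. The range of
  a matrix is the span of its columns.\<close>

definition linearized_AM ::
    "am_type \<Rightarrow> real ^ 'd ^ 'd \<Rightarrow> real ^ 'd \<Rightarrow> (nat \<Rightarrow> real) \<Rightarrow> (real ^ 'd) am_run \<Rightarrow> (real ^ 'd) am_run \<Rightarrow> nat \<Rightarrow> bool" where
  "linearized_AM tp A xs b T Th K \<longleftrightarrow>
    am_m Th = am_m T \<and>
    (let xh = am_x Th; ph = am_p Th; qh = am_q Th; vh = am_v tp Th; \<zeta>h = am_zeta Th; \<Gamma>h = am_Gamma Th;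
         mm = am_m T;
         rh = (\<lambda>j. - (A *v (xh j - xs)))
     in \<forall>k\<le>K.
       (mm k = 0 \<longrightarrow> xh k = am_x T k) \<and>
       (mm k = 1 \<longrightarrow> ph k = xh k - xh (k - 1) \<and> qh k = rh k - rh (k - 1)) \<and>
       (mm k \<ge> 2 \<longrightarrow>
          ph k = xh k - xh (k - 1) - (\<Sum>j=1..mm k-1. \<zeta>h k j *\<^sub>R ph (k - mm k + j)) \<and>
          qh k = rh k - rh (k - 1) - (\<Sum>j=1..mm k-1. \<zeta>h k j *\<^sub>R qh (k - mm k + j)) \<and>
          (\<forall>w\<in>span (vh ` {k - mm k + 1..k - 1}). qh k \<bullet> w = 0)) \<and>
       (mm k > 0 \<longrightarrow>
          (\<forall>w\<in>span (vh ` {k - mm k + 1..k}).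
             (rh k - (\<Sum>j=1..mm k. \<Gamma>h k j *\<^sub>R qh (k - mm k + j))) \<bullet> w = 0)) \<and>
       (k < K \<and> mm (k + 1) > 0 \<longrightarrow>
          xh (k + 1) = xh k + b k *\<^sub>R rh k -
            (\<Sum>j=1..mm k. \<Gamma>h k j *\<^sub>R (ph (k - mm k + j) + b k *\<^sub>R qh (k - mm k + j)))))"

text \<open>In the following, \<open>n\<close> stands for \<open>m\<^sub>k\<close>; within a restart cycle \<open>m\<^sub>k\<^sub>-\<^sub>1 = m\<^sub>k - 1\<close>. The indices of
  \<open>vec\<close> and \<open>mat\<close> start from 0.\<close>

definition Gamma_vec :: "'v am_run \<Rightarrow> nat \<Rightarrow> nat \<Rightarrow> real Matrix.vec" where
  "Gamma_vec T k n = Matrix.vec n (\<lambda>i. am_Gamma T k (i + 1))"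

definition phi_vec :: "'v am_run \<Rightarrow> nat \<Rightarrow> nat \<Rightarrow> real Matrix.vec" where
  "phi_vec T k n = Matrix.vec n (\<lambda>i. am_Gamma T k (i + 1) + am_zeta T (k + 1) (i + 1))"

text \<open>\<open>hess_bar b T k n H\<close> is \<open>H\<close> with the extra last row \<open>h\<^sub>k\<^sup>(\<^sup>n\<^sup>+\<^sup>1\<^sup>) e\<^sub>n\<^sup>T\<close>.\<close>

definition hess_bar :: "(nat \<Rightarrow> real) \<Rightarrow> 'v am_run \<Rightarrow> nat \<Rightarrow> nat \<Rightarrow> real mat \<Rightarrow> real mat" where
  "hess_bar b T k n H = Matrix.mat (n + 1) n (\<lambda>(i, j).
     if i < n then H $$ (i, j)
     else if j = n - 1 then - 1 / (b k * (1 - am_Gamma T k n)) else 0)"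

text \<open>The column \<open>h\<^sub>k\<close>, where \<open>Hb\<close> is \<open>hess_bar\<close> for \<open>k - 1\<close> (unused if \<open>n = 1\<close>).\<close>

definition hess_col :: "(nat \<Rightarrow> real) \<Rightarrow> 'v am_run \<Rightarrow> nat \<Rightarrow> nat \<Rightarrow> real mat \<Rightarrow> real Matrix.vec" where
  "hess_col b T k n Hb =
    (if n = 1 then
       Matrix.vec 1 (\<lambda>_. 1 / (1 - am_Gamma T k 1) *
         (1 / b (k - 1) - 1 / b k * vec_index (phi_vec T k 1) 0))
     else
       (1 / (1 - am_Gamma T k n)) \<cdot>\<^sub>v
         ((1 / b (k - 1)) \<cdot>\<^sub>v (phi_vec T (k - 1) (n - 1) @\<^sub>v Matrix.vec 1 (\<lambda>_. 1))
          - (1 / b k) \<cdot>\<^sub>v phi_vec T k n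
          - Hb *\<^sub>v (phi_vec T (k - 1) (n - 1) - Gamma_vec T k (n - 1))))"

fun hess_rec :: "(nat \<Rightarrow> real) \<Rightarrow> 'v am_run \<Rightarrow> nat \<Rightarrow> nat \<Rightarrow> real mat" where
  "hess_rec b T k 0 = 0\<^sub>m 0 0"
| "hess_rec b T k (Suc n) =
    (let Hb = hess_bar b T (k - 1) n (hess_rec b T (k - 1) n);
         h = hess_col b T k (Suc n) Hb
     in Matrix.mat (Suc n) (Suc n) (\<lambda>(i, j). if j < n then Hb $$ (i, j) else vec_index h i))"

definition hessenberg :: "(nat \<Rightarrow> real) \<Rightarrow> 'v am_run \<Rightarrow> nat \<Rightarrow> real mat" where
  "hessenberg b T k = hess_rec b T k (am_m T k)"

definition complex_spectrum :: "real mat \<Rightarrow> complex set" where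
  "complex_spectrum A = spectrum (map_mat complex_of_real A)"

definition vec_norm2 :: "real Matrix.vec \<Rightarrow> real" where
  "vec_norm2 v = L2_set (vec_index v) {..<dim_vec v}"

definition mat_norm2 :: "real mat \<Rightarrow> real" where
  "mat_norm2 A = (SUP v\<in>{v \<in> carrier_vec (dim_col A). vec_norm2 v = 1}. vec_norm2 (A *\<^sub>v v))"

end

theory Submission
  imports Defs
begin

text \<open>Let \<open>s\<close> be the start of the restart cycle that contains iteration \<open>k\<close>, let \<open>\<delta>\<close> be the distance of
  \<open>x\<^sub>s\<close> to \<open>x\<^sup>*\<close> and \<open>n = m\<^sub>k \<le> m\<close>. Within the cycle every quantity has a natural order in \<open>\<delta>\<close>: the errors
  \<open>x\<^sub>j - x\<^sup>*\<close>, the residuals and the vectors \<open>p\<^sub>j, q\<^sub>j\<close> have order 1, the inner products \<open>v\<^sub>i \<bullet> q\<^sub>j\<close> order 2,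
  and the coefficients \<open>\<zeta>, \<Gamma>\<close> and the Hessenberg entries order 0. The theorem rests on the fact that
  the two processes agree in all of these up to one further power of \<open>\<delta>\<close>. For the residuals as
  functions of the iterates this is the quadratic linearization error of \<open>h\<close>. The relation survives sums
  and products, and it survives the quotients in \<open>\<zeta>\<close> and \<open>\<Gamma>\<close> because the denominators
  \<open>v\<^sub>j \<bullet> q\<^sub>j\<close> are at least a multiple of \<open>\<delta>\<^sup>2\<close> (\<open>denominator_bound\<close>): the first one of a cycle by strong
  monotonicity of \<open>h\<close>, the later ones by the restart test with \<open>\<tau>\<close>. A cycle has at most
  \<open>m\<close> steps, so finitely many such operations lead to \<open>comparable_cycle\<close>, and, since \<open>\<beta>\<^sub>j\<close> and
  \<open>1 - \<Gamma>\<^sub>j\<close> stay away from zero, to \<open>comparable_hess_rec\<close>: \<open>H\<^sub>k\<close> is bounded and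
  \<open>H\<^sub>k - H'\<^sub>k = O(\<delta>)\<close>, where \<open>H'\<^sub>k\<close> is the matrix of Process II.

  The bounds on eigenvalues are then matrix analysis. An eigenvalue \<open>\<lambda>\<close> of \<open>H\<^sub>k\<close> is a bounded root of its
  characteristic polynomial, so the characteristic polynomial of \<open>H'\<^sub>k\<close> is \<open>O(\<delta>)\<close> at \<open>\<lambda>\<close>; as it is the
  product of the \<open>n\<close> differences between \<open>\<lambda>\<close> and the eigenvalues of \<open>H'\<^sub>k\<close>, the least distance is \<open>O(\<delta>\<^sup>1\<^sup>/\<^sup>n)\<close>. In the
  diagonalizable case the Bauer--Fike inequality (\<open>bauer_fike\<close>) gives \<open>O(\<delta>)\<close> times the condition number.
  The constant may depend on \<open>\<kappa>\<close>, so bounds in terms of \<open>\<delta>\<close> alone suffice and \<open>\<kappa>\<close> is factored out last.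

  The local estimates presuppose that the iterates lie in the ball around \<open>x\<^sup>*\<close>. A small \<open>h(x\<^sub>j)\<close> does not
  imply this, since \<open>h\<close> may be small elsewhere. But one step from iterates close to \<open>x\<^sup>*\<close> cannot leave
  the ball (\<open>one_step\<close>), and inside the ball \<open>h(x\<^sub>j)\<close> controls the distance to \<open>x\<^sup>*\<close>; alternating
  the two over all steps keeps the run near \<open>x\<^sup>*\<close> with a constant that does not grow
  (\<open>iterates_stay_near\<close>).

  Constants have to be uniform over all runs. Therefore quantities of runs are treated as
  functions on the set of all admissible runs, and estimates are eventual along the filter on this set that is
  generated by \<open>x\<^sub>0\<close> approaching \<open>x\<^sup>*\<close>.\<close>

section \<open>Families that agree to relative first order in a small parameter\<close>

text \<open>The elements of type \<open>'c\<close> are going to be whole runs with their parameters, so that a constant in an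
  estimate that holds eventually along \<open>F\<close> is uniform over the runs.\<close>

locale small_parameter =
  fixes F :: "'c filter" and \<delta> :: "'c \<Rightarrow> real"
  assumes positive: "eventually (\<lambda>c. 0 < \<delta> c) F"
    and tends_to_zero: "(\<delta> \<longlongrightarrow> 0) F"
begin

text \<open>A family of order \<open>k\<close> in \<open>\<delta>\<close> and an approximation of it whose error is one order smaller. Taking
  \<open>f' = f\<close> leaves the plain bound on \<open>f\<close>.\<close>

definition comparable :: "nat \<Rightarrow> ('c \<Rightarrow> 'a::real_normed_vector) \<Rightarrow> ('c \<Rightarrow> 'a) \<Rightarrow> bool" where
  "comparable k f f' \<longleftrightarrow> (\<exists>C>0. eventually (\<lambda>c.
     norm (f c) \<le> C * \<delta> c ^ k \<and> norm (f c - f' c) \<le> C * \<delta> c ^ Suc k) F)"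

lemma eventually_less:
  assumes "0 < e"
  shows "eventually (\<lambda>c. 0 < \<delta> c \<and> \<delta> c < e) F"
  using positive order_tendstoD(2)[OF tends_to_zero assms] by eventually_elim simp

lemma comparableI:
  assumes "eventually (\<lambda>c. norm (f c) \<le> C * \<delta> c ^ k \<and> norm (f c - f' c) \<le> C * \<delta> c ^ Suc k) F"
  shows "comparable k f f'"
proof -
  have "eventually (\<lambda>c. norm (f c) \<le> max C 1 * \<delta> c ^ k \<and> norm (f c - f' c) \<le> max C 1 * \<delta> c ^ Suc k) F"
    using assms positive
  proof eventually_elim
    case (elim c)
    then have "C * \<delta> c ^ k \<le> max C 1 * \<delta> c ^ k" "C * \<delta> c ^ Suc k \<le> max C 1 * \<delta> c ^ Suc k"
      by (intro mult_right_mono; simp)+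
    with elim show ?case by linarith
  qed
  then show ?thesis unfolding comparable_def by (intro exI[of _ "max C 1"]) auto
qed

lemma comparableE:
  assumes "comparable k f f'"
  obtains C where "0 < C"
    and "eventually (\<lambda>c. norm (f c) \<le> C * \<delta> c ^ k \<and> norm (f c - f' c) \<le> C * \<delta> c ^ Suc k) F"
  using assms unfolding comparable_def by blast

lemma comparable_cong:
  assumes "comparable k f f'"
    and "eventually (\<lambda>c. g c = f c) F" and "eventually (\<lambda>c. g' c = f' c) F"
  shows "comparable k g g'"
proof -
  obtain C where C: "eventually (\<lambda>c. norm (f c) \<le> C * \<delta> c ^ k \<and> norm (f c - f' c) \<le> C * \<delta> c ^ Suc k) F"
    using assms(1) by (rule comparableE)
  from C assms(2,3) have "eventually (\<lambda>c. norm (g c) \<le> C * \<delta> c ^ k \<and> norm (g c - g' c) \<le> C * \<delta> c ^ Suc k) F"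
    by eventually_elim simp
  then show ?thesis by (rule comparableI)
qed

lemma comparable_add:
  assumes "comparable k f f'" and "comparable k g g'"
  shows "comparable k (\<lambda>c. f c + g c) (\<lambda>c. f' c + g' c)"
proof -
  obtain C where C: "eventually (\<lambda>c. norm (f c) \<le> C * \<delta> c ^ k \<and> norm (f c - f' c) \<le> C * \<delta> c ^ Suc k) F"
    using assms(1) by (rule comparableE)
  obtain D where D: "eventually (\<lambda>c. norm (g c) \<le> D * \<delta> c ^ k \<and> norm (g c - g' c) \<le> D * \<delta> c ^ Suc k) F"
    using assms(2) by (rule comparableE)
  from C D have "eventually (\<lambda>c. norm (f c + g c) \<le> (C + D) * \<delta> c ^ k \<and>
      norm ((f c + g c) - (f' c + g' c)) \<le> (C + D) * \<delta> c ^ Suc k) F"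
  proof eventually_elim
    case (elim c)
    have "norm ((f c + g c) - (f' c + g' c)) \<le> norm (f c - f' c) + norm (g c - g' c)"
      using norm_triangle_ineq[of "f c - f' c" "g c - g' c"] by (simp add: algebra_simps)
    moreover have "norm (f c + g c) \<le> norm (f c) + norm (g c)" by (rule norm_triangle_ineq)
    ultimately show ?case using elim by (auto simp: algebra_simps)
  qed
  then show ?thesis by (rule comparableI)
qed

lemma comparable_zero: "comparable k (\<lambda>c. 0) (\<lambda>c. 0)"
  using positive by (intro comparableI[where C = 1]) (auto elim!: eventually_mono)

lemma comparable_sum:
  assumes "\<And>i. i \<in> I \<Longrightarrow> comparable k (f i) (f' i)"
  shows "comparable k (\<lambda>c. \<Sum>i\<in>I. f i c) (\<lambda>c. \<Sum>i\<in>I. f' i c)"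
  using assms
  by (induction I rule: infinite_finite_induct) (auto intro: comparable_add comparable_zero)

text \<open>Every product used below (of scalars, of a scalar and a vector, of two vectors) is a bounded
  bilinear map, and under such a map orders add up.\<close>

lemma comparable_bilinear:
  assumes "bounded_bilinear pr" and "comparable i f f'" and "comparable j g g'"
  shows "comparable (i + j) (\<lambda>c. pr (f c) (g c)) (\<lambda>c. pr (f' c) (g' c))"
proof -
  interpret bounded_bilinear pr by fact
  obtain C where "0 < C"
    and C: "eventually (\<lambda>c. norm (f c) \<le> C * \<delta> c ^ i \<and> norm (f c - f' c) \<le> C * \<delta> c ^ Suc i) F"
    using assms(2) by (rule comparableE)
  obtain D where "0 < D"
    and D: "eventually (\<lambda>c. norm (g c) \<le> D * \<delta> c ^ j \<and> norm (g c - g' c) \<le> D * \<delta> c ^ Suc j) F"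
    using assms(3) by (rule comparableE)
  obtain K where "0 < K" and K: "\<And>a b. norm (pr a b) \<le> norm a * norm b * K"
    using pos_bounded by blast
  have "eventually (\<lambda>c. norm (pr (f c) (g c)) \<le> (3 * C * D * K) * \<delta> c ^ (i + j) \<and>
      norm (pr (f c) (g c) - pr (f' c) (g' c)) \<le> (3 * C * D * K) * \<delta> c ^ Suc (i + j)) F"
    using C D eventually_less[of 1, simplified]
  proof eventually_elim
    case (elim c)
    have d: "0 < \<delta> c" "\<delta> c < 1" using elim by auto
    have "\<delta> c ^ Suc j \<le> \<delta> c ^ j" using d by (intro power_decreasing) auto
    then have "D * \<delta> c ^ Suc j \<le> D * \<delta> c ^ j" using \<open>0 < D\<close> by (intro mult_left_mono) auto
    then have g': "norm (g' c) \<le> 2 * D * \<delta> c ^ j"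
      using elim norm_triangle_ineq4[of "g c" "g c - g' c"] by auto
    have "norm (pr (f c) (g c)) \<le> norm (f c) * norm (g c) * K" by (rule K)
    also have "\<dots> \<le> (C * \<delta> c ^ i) * (D * \<delta> c ^ j) * K"
      using elim \<open>0 < C\<close> \<open>0 < K\<close> d by (intro mult_right_mono mult_mono) auto
    also have "\<dots> \<le> (3 * C * D * K) * \<delta> c ^ (i + j)"
      using \<open>0 < C\<close> \<open>0 < D\<close> \<open>0 < K\<close> d by (simp add: power_add)
    finally have 1: "norm (pr (f c) (g c)) \<le> (3 * C * D * K) * \<delta> c ^ (i + j)" .
    have "norm (pr (f c) (g c - g' c)) \<le> norm (f c) * norm (g c - g' c) * K" by (rule K)
    also have "\<dots> \<le> (C * \<delta> c ^ i) * (D * \<delta> c ^ Suc j) * K"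
      using elim \<open>0 < C\<close> \<open>0 < K\<close> d by (intro mult_right_mono mult_mono) auto
    finally have 2: "norm (pr (f c) (g c - g' c)) \<le> (C * D * K) * \<delta> c ^ Suc (i + j)"
      by (simp add: power_add algebra_simps)
    have "norm (pr (f c - f' c) (g' c)) \<le> norm (f c - f' c) * norm (g' c) * K" by (rule K)
    also have "\<dots> \<le> (C * \<delta> c ^ Suc i) * (2 * D * \<delta> c ^ j) * K"
      using elim g' \<open>0 < C\<close> \<open>0 < K\<close> d by (intro mult_right_mono mult_mono) auto
    finally have 3: "norm (pr (f c - f' c) (g' c)) \<le> (2 * C * D * K) * \<delta> c ^ Suc (i + j)"
      by (simp add: power_add algebra_simps)
    have "pr (f c) (g c) - pr (f' c) (g' c) = pr (f c) (g c - g' c) + pr (f c - f' c) (g' c)"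
      by (simp add: diff_left diff_right)
    then have "norm (pr (f c) (g c) - pr (f' c) (g' c)) \<le> (3 * C * D * K) * \<delta> c ^ Suc (i + j)"
      using norm_triangle_ineq[of "pr (f c) (g c - g' c)" "pr (f c - f' c) (g' c)"] 2 3
      by (simp add: algebra_simps)
    with 1 show ?case by blast
  qed
  then show ?thesis by (rule comparableI)
qed

lemma comparable_bounded:
  assumes "eventually (\<lambda>c. norm (f c) \<le> B) F"
  shows "comparable 0 f f"
proof (rule comparableI[where C = B])
  show "eventually (\<lambda>c. norm (f c) \<le> B * \<delta> c ^ 0 \<and> norm (f c - f c) \<le> B * \<delta> c ^ Suc 0) F"
    using assms positive
  proof eventually_elim
    case (elim c)
    then have "0 \<le> B" using norm_ge_zero order_trans by blast
    with elim show ?case by simp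
  qed
qed

lemma comparable_const: "comparable 0 (\<lambda>c. a) (\<lambda>c. a)"
  by (rule comparable_bounded[where B = "norm a"]) simp

lemma comparable_scaleR:
  "comparable 0 f f' \<Longrightarrow> comparable k g g' \<Longrightarrow> comparable k (\<lambda>c. f c *\<^sub>R g c) (\<lambda>c. f' c *\<^sub>R g' c)"
  using comparable_bilinear[OF bounded_bilinear_scaleR, of 0 f f' k g g'] by simp

lemma comparable_mult:
  fixes f f' g g' :: "'c \<Rightarrow> 'a::real_normed_algebra"
  shows "comparable 0 f f' \<Longrightarrow> comparable k g g' \<Longrightarrow> comparable k (\<lambda>c. f c * g c) (\<lambda>c. f' c * g' c)"
  using comparable_bilinear[OF bounded_bilinear_mult, of 0 f f' k g g'] by simp

lemma comparable_inner:
  fixes f f' g g' :: "'c \<Rightarrow> 'a::real_inner"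
  shows "comparable 1 f f' \<Longrightarrow> comparable 1 g g' \<Longrightarrow> comparable 2 (\<lambda>c. f c \<bullet> g c) (\<lambda>c. f' c \<bullet> g' c)"
  using comparable_bilinear[OF bounded_bilinear_inner, of 1 f f' 1 g g'] by (simp add: numeral_2_eq_2)

lemma comparable_diff:
  assumes "comparable k f f'" and "comparable k g g'"
  shows "comparable k (\<lambda>c. f c - g c) (\<lambda>c. f' c - g' c)"
  using comparable_add[OF assms(1) comparable_scaleR[OF comparable_const[of "- 1 :: real"] assms(2)]] by simp

lemma comparable_prod:
  fixes f f' :: "'i \<Rightarrow> 'c \<Rightarrow> 'a::{real_normed_algebra_1,comm_monoid_mult}"
  assumes "\<And>i. i \<in> I \<Longrightarrow> comparable 0 (f i) (f' i)"
  shows "comparable 0 (\<lambda>c. \<Prod>i\<in>I. f i c) (\<lambda>c. \<Prod>i\<in>I. f' i c)"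
  using assms
  by (induction I rule: infinite_finite_induct) (auto intro: comparable_mult comparable_const)

lemma comparable_away_from_zero:
  assumes "comparable k g g'" and "0 < e" and "eventually (\<lambda>c. e * \<delta> c ^ k \<le> norm (g c)) F"
  shows "eventually (\<lambda>c. e / 2 * \<delta> c ^ k \<le> norm (g' c)) F"
proof -
  obtain C where "0 < C"
    and C: "eventually (\<lambda>c. norm (g c) \<le> C * \<delta> c ^ k \<and> norm (g c - g' c) \<le> C * \<delta> c ^ Suc k) F"
    using assms(1) by (rule comparableE)
  have "0 < e / (2 * C)" using assms(2) \<open>0 < C\<close> by simp
  from C assms(3) eventually_less[OF this] show ?thesis
  proof eventually_elim
    case (elim c)
    then have "C * \<delta> c \<le> e / 2" using \<open>0 < C\<close> by (simp add: field_simps)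
    then have "(C * \<delta> c) * \<delta> c ^ k \<le> e / 2 * \<delta> c ^ k" using elim by (intro mult_right_mono) auto
    moreover have "norm (g c - g' c) \<le> (C * \<delta> c) * \<delta> c ^ k" using elim by (simp add: mult.assoc)
    ultimately have "norm (g c - g' c) \<le> e / 2 * \<delta> c ^ k" by linarith
    then show ?case using elim norm_triangle_ineq2[of "g c" "g c - g' c"] by auto
  qed
qed

text \<open>The lower bound is required of the denominator \<open>g\<close> only: the difference to \<open>g'\<close> is of smaller order, so
  \<open>g'\<close> inherits it with half the constant once \<open>\<delta>\<close> is small.\<close>

lemma comparable_divide:
  fixes f f' g g' :: "'c \<Rightarrow> real"
  assumes "comparable k f f'" and g: "comparable k g g'"
    and "0 < e" and e: "eventually (\<lambda>c. e * \<delta> c ^ k \<le> \<bar>g c\<bar>) F"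
  shows "comparable 0 (\<lambda>c. f c / g c) (\<lambda>c. f' c / g' c)"
proof -
  obtain C where "0 < C"
    and C: "eventually (\<lambda>c. norm (f c) \<le> C * \<delta> c ^ k \<and> norm (f c - f' c) \<le> C * \<delta> c ^ Suc k) F"
    using assms(1) by (rule comparableE)
  obtain D where "0 < D"
    and D: "eventually (\<lambda>c. norm (g c) \<le> D * \<delta> c ^ k \<and> norm (g c - g' c) \<le> D * \<delta> c ^ Suc k) F"
    using assms(2) by (rule comparableE)
  have e': "eventually (\<lambda>c. e / 2 * \<delta> c ^ k \<le> \<bar>g' c\<bar>) F"
    using comparable_away_from_zero[OF g \<open>0 < e\<close>] e by simp
  let ?B = "C / e + 2 * C * D / e\<^sup>2 + 2 * C / e"
  have "eventually (\<lambda>c. norm (f c / g c) \<le> ?B * \<delta> c ^ 0 \<and>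
      norm (f c / g c - f' c / g' c) \<le> ?B * \<delta> c ^ Suc 0) F"
    using C D e e' positive
  proof eventually_elim
    case (elim c)
    define d where "d = \<delta> c ^ k"
    have d: "0 < d" "\<delta> c ^ Suc k = d * \<delta> c" using elim by (auto simp: d_def)
    have g: "e * d \<le> \<bar>g c\<bar>" "e / 2 * d \<le> \<bar>g' c\<bar>" using elim by (auto simp: d_def)
    have ed: "0 < e * d" "0 < e / 2 * d" using d \<open>0 < e\<close> by auto
    have nz: "g c \<noteq> 0" "g' c \<noteq> 0" using g ed by auto
    have 1: "\<bar>f c / g c\<bar> \<le> C / e"
    proof -
      have "\<bar>f c / g c\<bar> \<le> (C * d) / (e * d)"
        unfolding abs_divide using elim g ed by (intro frac_le) (auto simp: d_def)
      then show ?thesis using d by simp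
    qed
    have 2: "\<bar>f c * (g' c - g c) / (g c * g' c)\<bar> \<le> 2 * C * D / e\<^sup>2 * \<delta> c"
    proof -
      have "\<bar>f c * (g' c - g c) / (g c * g' c)\<bar> \<le> ((C * d) * (D * (d * \<delta> c))) / ((e * d) * (e / 2 * d))"
        unfolding abs_divide abs_mult
      proof (intro frac_le mult_mono mult_pos_pos mult_nonneg_nonneg)
        show "\<bar>f c\<bar> \<le> C * d" "\<bar>g' c - g c\<bar> \<le> D * (d * \<delta> c)"
          using elim by (auto simp: d_def abs_minus_commute algebra_simps)
      qed (use g d elim \<open>0 < C\<close> \<open>0 < D\<close> \<open>0 < e\<close> in auto)
      then show ?thesis using d \<open>0 < e\<close> by (simp add: power2_eq_square field_simps)
    qed
    have 3: "\<bar>(f c - f' c) / g' c\<bar> \<le> 2 * C / e * \<delta> c"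
    proof -
      have "\<bar>f c - f' c\<bar> \<le> C * (d * \<delta> c)"
        using elim d(2) by (simp add: mult.commute)
      then have "\<bar>(f c - f' c) / g' c\<bar> \<le> (C * (d * \<delta> c)) / (e / 2 * d)"
        unfolding abs_divide by (intro frac_le g ed) auto
      then show ?thesis using d \<open>0 < e\<close> by (simp add: field_simps)
    qed
    \<comment> \<open>change the denominator first and the numerator second\<close>
    have eq: "f c / g c - f' c / g' c = f c * (g' c - g c) / (g c * g' c) + (f c - f' c) / g' c"
      using nz by (simp add: field_simps)
    have 4: "\<bar>f c / g c - f' c / g' c\<bar> \<le> (2 * C * D / e\<^sup>2 + 2 * C / e) * \<delta> c"
      unfolding eq distrib_right by (rule order_trans[OF abs_triangle_ineq add_mono[OF 2 3]])
    have nonneg: "0 \<le> C / e" "0 \<le> 2 * C * D / e\<^sup>2 + 2 * C / e"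
      using \<open>0 < C\<close> \<open>0 < D\<close> \<open>0 < e\<close> by auto
    then have "\<bar>f c / g c\<bar> \<le> ?B" using 1 by linarith
    moreover have "(2 * C * D / e\<^sup>2 + 2 * C / e) * \<delta> c \<le> ?B * \<delta> c"
      using nonneg elim by (intro mult_right_mono) auto
    ultimately show ?case using 4 by (simp only: real_norm_def power_0 power_Suc0_right mult_1_right) auto
  qed
  then show ?thesis by (rule comparableI)
qed

end

text \<open>The filter generated by the sets of all \<open>c \<in> V\<close> with \<open>\<bar>a c\<bar>\<close> below a positive bound. With \<open>V\<close> a set of runs and
  \<open>a\<close> the initial error, an eventual property holds for all runs that start close enough to the solution.\<close>

definition vanishing_on :: "('c \<Rightarrow> real) \<Rightarrow> 'c set \<Rightarrow> 'c filter" where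
  "vanishing_on a V = inf (filtercomap a (nhds 0)) (principal V)"

lemma eventually_vanishing_on:
  "eventually P (vanishing_on a V) \<longleftrightarrow> (\<exists>e>0. \<forall>c\<in>V. \<bar>a c\<bar> \<le> e \<longrightarrow> P c)"
proof -
  have "eventually P (vanishing_on a V) \<longleftrightarrow> (\<exists>Q. (\<exists>d>0. \<forall>x. \<bar>x\<bar> < d \<longrightarrow> Q x) \<and> (\<forall>c. Q (a c) \<longrightarrow> c \<in> V \<longrightarrow> P c))"
    unfolding vanishing_on_def eventually_inf_principal eventually_filtercomap eventually_nhds_metric
    by (simp add: dist_real_def)
  also have "\<dots> \<longleftrightarrow> (\<exists>d>0. \<forall>c\<in>V. \<bar>a c\<bar> < d \<longrightarrow> P c)"
  proof
    assume "\<exists>d>0. \<forall>c\<in>V. \<bar>a c\<bar> < d \<longrightarrow> P c"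
    then obtain d where "0 < d" "\<forall>c\<in>V. \<bar>a c\<bar> < d \<longrightarrow> P c" by blast
    then show "\<exists>Q. (\<exists>d>0. \<forall>x. \<bar>x\<bar> < d \<longrightarrow> Q x) \<and> (\<forall>c. Q (a c) \<longrightarrow> c \<in> V \<longrightarrow> P c)"
      by (intro exI[of _ "\<lambda>x. \<bar>x\<bar> < d"]) blast
  qed blast
  also have "\<dots> \<longleftrightarrow> (\<exists>e>0. \<forall>c\<in>V. \<bar>a c\<bar> \<le> e \<longrightarrow> P c)"
  proof
    assume "\<exists>d>0. \<forall>c\<in>V. \<bar>a c\<bar> < d \<longrightarrow> P c"
    then obtain d where "0 < d" "\<forall>c\<in>V. \<bar>a c\<bar> < d \<longrightarrow> P c" by blast
    then show "\<exists>e>0. \<forall>c\<in>V. \<bar>a c\<bar> \<le> e \<longrightarrow> P c" by (intro exI[of _ "d / 2"]) auto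
  qed force
  finally show ?thesis .
qed

lemma eventually_vanishing_onI: "(\<And>c. c \<in> V \<Longrightarrow> P c) \<Longrightarrow> eventually P (vanishing_on a V)"
  unfolding eventually_vanishing_on by (intro exI[of _ 1]) auto

lemma tendsto_vanishing_on: "(a \<longlongrightarrow> 0) (vanishing_on a V)"
  unfolding vanishing_on_def
  by (rule filterlim_mono[OF filterlim_filtercomap order_refl inf_le1])

text \<open>The estimates are obtained separately for each length of a cycle, and only the lengths up to \<open>m\<close> occur.\<close>

lemma uniform_over_finite_range:
  fixes P :: "nat \<Rightarrow> real \<Rightarrow> real \<Rightarrow> bool"
  assumes ex: "\<And>n. n \<le> m \<Longrightarrow> \<exists>e>0. \<exists>C>0. P n e C"
    and mono: "\<And>n e C e' C'. P n e C \<Longrightarrow> e' \<le> e \<Longrightarrow> C \<le> C' \<Longrightarrow> P n e' C'"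
  shows "\<exists>e>0. \<exists>C>0. \<forall>n\<le>m. P n e C"
  using ex
proof (induction m)
  case 0
  then show ?case by auto
next
  case (Suc m)
  from Suc.IH[OF Suc.prems] obtain e C where eC: "0 < e" "0 < C" "\<forall>n\<le>m. P n e C" by auto
  from Suc.prems[of "Suc m"] obtain e' C' where eC': "0 < e'" "0 < C'" "P (Suc m) e' C'" by auto
  have "P n (min e e') (max C C')" if "n \<le> Suc m" for n
  proof (cases "n = Suc m")
    case True
    then show ?thesis using mono[OF eC'(3)] by simp
  next
    case False
    then have "P n e C" using eC(3) that by simp
    then show ?thesis by (rule mono) auto
  qed
  moreover have "0 < min e e'" "0 < max C C'" using eC eC' by auto
  ultimately show ?case by blast
qed

section \<open>Perturbation of one restart cycle\<close>

text \<open>Orthogonality after each single elimination step. This form makes sense without any condition on the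
  denominators, and both descriptions of coefficients lead to it: the successive quotients of the restarted method
  (\<open>elimination_coeffs_iff\<close>) and the orthogonality of the final remainder to all \<open>v\<^sub>j\<close> in the linearized
  process (\<open>elimination_coeffs_of_orthogonal\<close>).\<close>

definition elimination_coeffs ::
    "(nat \<Rightarrow> 'v::real_inner) \<Rightarrow> (nat \<Rightarrow> 'v) \<Rightarrow> nat \<Rightarrow> 'v \<Rightarrow> (nat \<Rightarrow> real) \<Rightarrow> bool" where
  "elimination_coeffs v q n a z \<longleftrightarrow> (\<forall>j\<in>{1..n}. v j \<bullet> (a - (\<Sum>l=1..j. z l *\<^sub>R q l)) = 0)"

lemma elimination_coeffs_iff:
  assumes "\<And>j. j \<in> {1..n} \<Longrightarrow> v j \<bullet> q j \<noteq> 0"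
  shows "elimination_coeffs v q n a z \<longleftrightarrow>
    (\<forall>j\<in>{1..n}. z j = (v j \<bullet> (a - (\<Sum>l=1..<j. z l *\<^sub>R q l))) / (v j \<bullet> q j))"
proof -
  have "v j \<bullet> (a - (\<Sum>l=1..j. z l *\<^sub>R q l)) = 0 \<longleftrightarrow>
      z j = (v j \<bullet> (a - (\<Sum>l=1..<j. z l *\<^sub>R q l))) / (v j \<bullet> q j)" if "j \<in> {1..n}" for j
  proof -
    have "{1..j} = insert j {1..<j}" using that by auto
    then show ?thesis
      using assms[OF that] by (auto simp: inner_diff_right inner_add_right field_simps)
  qed
  then show ?thesis unfolding elimination_coeffs_def by blast
qed

text \<open>The triangularity \<open>v\<^sub>j \<bullet> q\<^sub>l = 0\<close> for \<open>j < l\<close> makes the steps after \<open>j\<close> invisible to \<open>v\<^sub>j\<close>.\<close>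

lemma elimination_coeffs_of_orthogonal:
  assumes orth: "\<And>j. j \<in> {1..n} \<Longrightarrow> v j \<bullet> (a - (\<Sum>l=1..n. z l *\<^sub>R q l)) = 0"
    and tri: "\<And>j l. 1 \<le> j \<Longrightarrow> j < l \<Longrightarrow> l \<le> n \<Longrightarrow> v j \<bullet> q l = 0"
  shows "elimination_coeffs v q n a z"
  unfolding elimination_coeffs_def
proof
  fix j assume j: "j \<in> {1..n}"
  then have "{1..n} = {1..j} \<union> {Suc j..n}" by auto
  then have "(\<Sum>l=1..n. z l *\<^sub>R q l) = (\<Sum>l=1..j. z l *\<^sub>R q l) + (\<Sum>l=Suc j..n. z l *\<^sub>R q l)"
    by (simp only:) (subst sum.union_disjoint, auto)
  moreover have "v j \<bullet> (\<Sum>l=Suc j..n. z l *\<^sub>R q l) = 0"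
    unfolding inner_sum_right using tri j by (intro sum.neutral) auto
  ultimately show "v j \<bullet> (a - (\<Sum>l=1..j. z l *\<^sub>R q l)) = 0"
    using orth[OF j] by (simp add: inner_diff_right inner_add_right)
qed

context small_parameter
begin

text \<open>Once the denominators of both families are known to be nonzero, the orthogonality relations determine the
  coefficients one after the other as quotients.\<close>

lemma comparable_elimination_coeffs:
  fixes v q :: "'c \<Rightarrow> nat \<Rightarrow> 'v::real_inner"
  assumes "eventually (\<lambda>c. elimination_coeffs (v c) (q c) n (a c) (z c)) F"
    and "eventually (\<lambda>c. elimination_coeffs (v' c) (q' c) n (a' c) (z' c)) F"
    and v: "\<And>j. j \<in> {1..n} \<Longrightarrow> comparable 1 (\<lambda>c. v c j) (\<lambda>c. v' c j)"
    and q: "\<And>j. j \<in> {1..n} \<Longrightarrow> comparable 1 (\<lambda>c. q c j) (\<lambda>c. q' c j)"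
    and a: "comparable 1 a a'"
    and "0 < e" and e: "\<And>j. j \<in> {1..n} \<Longrightarrow> eventually (\<lambda>c. e * (\<delta> c)\<^sup>2 \<le> \<bar>v c j \<bullet> q c j\<bar>) F"
    and "j \<in> {1..n}"
  shows "comparable 0 (\<lambda>c. z c j) (\<lambda>c. z' c j)"
proof -
  have nz: "eventually (\<lambda>c. \<forall>j\<in>{1..n}. v c j \<bullet> q c j \<noteq> 0) F"
  proof (intro eventually_ball_finite ballI)
    fix j assume j: "j \<in> {1..n}"
    show "eventually (\<lambda>c. v c j \<bullet> q c j \<noteq> 0) F"
      using e[OF j] positive
    proof eventually_elim
      case (elim c)
      have "0 < e * (\<delta> c)\<^sup>2" using elim \<open>0 < e\<close> by simp
      then show ?case using elim by auto
    qed
  qed simp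
  have nz': "eventually (\<lambda>c. \<forall>j\<in>{1..n}. v' c j \<bullet> q' c j \<noteq> 0) F"
  proof (intro eventually_ball_finite ballI)
    fix j assume j: "j \<in> {1..n}"
    have "eventually (\<lambda>c. e / 2 * (\<delta> c)\<^sup>2 \<le> norm (v' c j \<bullet> q' c j)) F"
      by (rule comparable_away_from_zero[OF comparable_inner[OF v[OF j] q[OF j]] \<open>0 < e\<close>])
        (use e[OF j] in simp)
    then show "eventually (\<lambda>c. v' c j \<bullet> q' c j \<noteq> 0) F"
      using positive
    proof eventually_elim
      case (elim c)
      have "0 < e / 2 * (\<delta> c)\<^sup>2" using elim \<open>0 < e\<close> by simp
      then show ?case using elim by auto
    qed
  qed simp
  have z: "eventually (\<lambda>c. z c j = (v c j \<bullet> (a c - (\<Sum>l=1..<j. z c l *\<^sub>R q c l))) / (v c j \<bullet> q c j)) F"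
    if "j \<in> {1..n}" for j
    using assms(1) nz
  proof eventually_elim
    case (elim c)
    then show ?case using elimination_coeffs_iff[of n "v c" "q c"] that by blast
  qed
  have z': "eventually (\<lambda>c. z' c j = (v' c j \<bullet> (a' c - (\<Sum>l=1..<j. z' c l *\<^sub>R q' c l))) / (v' c j \<bullet> q' c j)) F"
    if "j \<in> {1..n}" for j
    using assms(2) nz'
  proof eventually_elim
    case (elim c)
    then show ?case using elimination_coeffs_iff[of n "v' c" "q' c"] that by blast
  qed
  show ?thesis
    using \<open>j \<in> {1..n}\<close>
  proof (induction j rule: less_induct)
    case (less j)
    have "comparable 1 (\<lambda>c. a c - (\<Sum>l=1..<j. z c l *\<^sub>R q c l)) (\<lambda>c. a' c - (\<Sum>l=1..<j. z' c l *\<^sub>R q' c l))"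
      using less by (intro comparable_diff comparable_sum comparable_scaleR a q) auto
    from comparable_divide[OF comparable_inner[OF v[OF less.prems] this]
        comparable_inner[OF v[OF less.prems] q[OF less.prems]] \<open>0 < e\<close> e[OF less.prems]]
    show ?case by (rule comparable_cong[OF _ z[OF less.prems] z'[OF less.prems]])
  qed
qed

end

text \<open>The relations that Process I and Process II have in common during the iterations \<open>s, \<dots>, s + n\<close> of a cycle
  that starts at \<open>s\<close>. The two processes differ only in the dependence of the residuals \<open>r\<close> on the iterates,
  which is left open here.\<close>

definition mixing_cycle ::
    "am_type \<Rightarrow> (nat \<Rightarrow> real) \<Rightarrow> (nat \<Rightarrow> 'v::real_inner) \<Rightarrow> 'v am_run \<Rightarrow> nat \<Rightarrow> nat \<Rightarrow> bool" where
  "mixing_cycle tp b r T s n \<longleftrightarrow>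
    (let x = am_x T; p = am_p T; q = am_q T; \<zeta> = am_zeta T; \<Gamma> = am_Gamma T;
         el = elimination_coeffs (\<lambda>j. am_v tp T (s + j)) (\<lambda>j. q (s + j))
     in
       (\<forall>i<n.
          x (s + Suc i) = (x (s + i) - (\<Sum>j=1..i. \<Gamma> (s + i) j *\<^sub>R p (s + j))) +
            b (s + i) *\<^sub>R (r (s + i) - (\<Sum>j=1..i. \<Gamma> (s + i) j *\<^sub>R q (s + j))) \<and>
          p (s + Suc i) = x (s + Suc i) - x (s + i) - (\<Sum>j=1..i. \<zeta> (s + Suc i) j *\<^sub>R p (s + j)) \<and>
          q (s + Suc i) = r (s + Suc i) - r (s + i) - (\<Sum>j=1..i. \<zeta> (s + Suc i) j *\<^sub>R q (s + j)) \<and>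
          el i (r (s + Suc i) - r (s + i)) (\<zeta> (s + Suc i))) \<and>
       (\<forall>i\<le>n. el i (r (s + i)) (\<Gamma> (s + i))))"

context small_parameter
begin

text \<open>Induction along the cycle: the update and the two recurrences only use sums and products of comparable
  families, and the coefficients are quotients whose denominators are bounded below by a multiple of \<open>\<delta>\<^sup>2\<close>.\<close>

lemma comparable_cycle:
  fixes T T' :: "'c \<Rightarrow> ('v::real_inner) am_run" and r r' :: "'c \<Rightarrow> nat \<Rightarrow> 'v"
  assumes cycle: "eventually (\<lambda>c. mixing_cycle tp (b c) (r c) (T c) (s c) n) F"
    and cycle': "eventually (\<lambda>c. mixing_cycle tp (b c) (r' c) (T' c) (s c) n) F"
    and b: "eventually (\<lambda>c. \<forall>j. \<bar>b c j\<bar> \<le> B) F"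
    and start: "comparable 1 (\<lambda>c. am_x (T c) (s c) - a) (\<lambda>c. am_x (T' c) (s c) - a)"
    and residual: "\<And>i. i \<le> n \<Longrightarrow>
        comparable 1 (\<lambda>c. am_x (T c) (s c + i) - a) (\<lambda>c. am_x (T' c) (s c + i) - a) \<Longrightarrow>
        comparable 1 (\<lambda>c. r c (s c + i)) (\<lambda>c. r' c (s c + i))"
    and "0 < e"
    and e: "eventually (\<lambda>c. \<forall>j\<in>{1..n}.
        e * (\<delta> c)\<^sup>2 \<le> \<bar>am_v tp (T c) (s c + j) \<bullet> am_q (T c) (s c + j)\<bar>) F"
    and "i \<le> n"
  shows "comparable 1 (\<lambda>c. am_x (T c) (s c + i) - a) (\<lambda>c. am_x (T' c) (s c + i) - a)" (is "?x i")
    and "comparable 1 (\<lambda>c. r c (s c + i)) (\<lambda>c. r' c (s c + i))" (is "?r i")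
    and "j \<in> {1..i} \<Longrightarrow> comparable 1 (\<lambda>c. am_p (T c) (s c + j)) (\<lambda>c. am_p (T' c) (s c + j))" (is "_ \<Longrightarrow> ?p j")
    and "j \<in> {1..i} \<Longrightarrow> comparable 1 (\<lambda>c. am_q (T c) (s c + j)) (\<lambda>c. am_q (T' c) (s c + j))" (is "_ \<Longrightarrow> ?q j")
    and "j \<in> {1..i} \<Longrightarrow> comparable 0 (\<lambda>c. am_Gamma (T c) (s c + i) j) (\<lambda>c. am_Gamma (T' c) (s c + i) j)" (is "_ \<Longrightarrow> ?G i j")
    and "j \<in> {1..<i} \<Longrightarrow> comparable 0 (\<lambda>c. am_zeta (T c) (s c + i) j) (\<lambda>c. am_zeta (T' c) (s c + i) j)" (is "_ \<Longrightarrow> ?z i j")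
proof -
  have b: "comparable 0 (\<lambda>c. b c (s c + i)) (\<lambda>c. b c (s c + i))" for i
    by (rule comparable_bounded[where B = B]) (use b in eventually_elim, simp)
  have e: "eventually (\<lambda>c. e * (\<delta> c)\<^sup>2 \<le> \<bar>am_v tp (T c) (s c + j) \<bullet> am_q (T c) (s c + j)\<bar>) F"
    if "j \<in> {1..n}" for j
    using e by eventually_elim (use that in blast)
  have v: "comparable 1 (\<lambda>c. am_v tp (T c) (s c + j)) (\<lambda>c. am_v tp (T' c) (s c + j))" if "?p j" "?q j" for j
    using that by (cases tp) (simp_all add: am_v_def)
  have el: "comparable 0 (\<lambda>c. z c j) (\<lambda>c. z' c j)"
    if "eventually (\<lambda>c. elimination_coeffs (\<lambda>j. am_v tp (T c) (s c + j)) (\<lambda>j. am_q (T c) (s c + j)) i (y c) (z c)) F"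
      and "eventually (\<lambda>c. elimination_coeffs (\<lambda>j. am_v tp (T' c) (s c + j)) (\<lambda>j. am_q (T' c) (s c + j)) i (y' c) (z' c)) F"
      and "comparable 1 y y'" and "\<And>j. j \<in> {1..i} \<Longrightarrow> ?p j" and "\<And>j. j \<in> {1..i} \<Longrightarrow> ?q j"
      and "i \<le> n" and "j \<in> {1..i}"
    for i j y y' z z'
    using that by (intro comparable_elimination_coeffs[OF that(1,2) v _ that(3) \<open>0 < e\<close> e]) auto
  have G: "?G i j" if "?r i" "\<And>j. j \<in> {1..i} \<Longrightarrow> ?p j" "\<And>j. j \<in> {1..i} \<Longrightarrow> ?q j" "i \<le> n" "j \<in> {1..i}" for i j
  proof (rule el)
    show "eventually (\<lambda>c. elimination_coeffs (\<lambda>j. am_v tp (T c) (s c + j)) (\<lambda>j. am_q (T c) (s c + j)) i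
        (r c (s c + i)) (am_Gamma (T c) (s c + i))) F"
      using cycle by eventually_elim (use \<open>i \<le> n\<close> in \<open>simp add: mixing_cycle_def Let_def\<close>)
    show "eventually (\<lambda>c. elimination_coeffs (\<lambda>j. am_v tp (T' c) (s c + j)) (\<lambda>j. am_q (T' c) (s c + j)) i
        (r' c (s c + i)) (am_Gamma (T' c) (s c + i))) F"
      using cycle' by eventually_elim (use \<open>i \<le> n\<close> in \<open>simp add: mixing_cycle_def Let_def\<close>)
  qed (use that in auto)
  have main: "i \<le> n \<Longrightarrow> ?x i \<and> ?r i \<and> (\<forall>j\<in>{1..i}. ?p j \<and> ?q j) \<and> (\<forall>j\<in>{1..<i}. ?z i j)" for i
  proof (induction i)
    case 0
    then show ?case using start residual[of 0] by simp
  next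
    case (Suc i)
    then have i: "i < n" and IH: "?x i" "?r i" "\<And>j. j \<in> {1..i} \<Longrightarrow> ?p j" "\<And>j. j \<in> {1..i} \<Longrightarrow> ?q j"
      by auto
    have G: "?G i j" if "j \<in> {1..i}" for j
      using G IH i that by simp
    have "comparable 1
        (\<lambda>c. ((am_x (T c) (s c + i) - a) - (\<Sum>j=1..i. am_Gamma (T c) (s c + i) j *\<^sub>R am_p (T c) (s c + j))) +
          b c (s c + i) *\<^sub>R (r c (s c + i) - (\<Sum>j=1..i. am_Gamma (T c) (s c + i) j *\<^sub>R am_q (T c) (s c + j))))
        (\<lambda>c. ((am_x (T' c) (s c + i) - a) - (\<Sum>j=1..i. am_Gamma (T' c) (s c + i) j *\<^sub>R am_p (T' c) (s c + j))) +
          b c (s c + i) *\<^sub>R (r' c (s c + i) - (\<Sum>j=1..i. am_Gamma (T' c) (s c + i) j *\<^sub>R am_q (T' c) (s c + j))))"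
      by (intro comparable_add comparable_diff comparable_sum comparable_scaleR b G IH)
    then have x: "?x (Suc i)"
    proof (rule comparable_cong)
      show "eventually (\<lambda>c. am_x (T c) (s c + Suc i) - a =
          ((am_x (T c) (s c + i) - a) - (\<Sum>j=1..i. am_Gamma (T c) (s c + i) j *\<^sub>R am_p (T c) (s c + j))) +
          b c (s c + i) *\<^sub>R (r c (s c + i) - (\<Sum>j=1..i. am_Gamma (T c) (s c + i) j *\<^sub>R am_q (T c) (s c + j)))) F"
        using cycle by eventually_elim (use i in \<open>auto simp add: mixing_cycle_def Let_def\<close>)
      show "eventually (\<lambda>c. am_x (T' c) (s c + Suc i) - a =
          ((am_x (T' c) (s c + i) - a) - (\<Sum>j=1..i. am_Gamma (T' c) (s c + i) j *\<^sub>R am_p (T' c) (s c + j))) +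
          b c (s c + i) *\<^sub>R (r' c (s c + i) - (\<Sum>j=1..i. am_Gamma (T' c) (s c + i) j *\<^sub>R am_q (T' c) (s c + j)))) F"
        using cycle' by eventually_elim (use i in \<open>auto simp add: mixing_cycle_def Let_def\<close>)
    qed
    then have r: "?r (Suc i)" using residual[of "Suc i"] i by simp
    have z: "?z (Suc i) j" if "j \<in> {1..i}" for j
    proof (rule el)
      show "eventually (\<lambda>c. elimination_coeffs (\<lambda>j. am_v tp (T c) (s c + j)) (\<lambda>j. am_q (T c) (s c + j)) i
          (r c (s c + Suc i) - r c (s c + i)) (am_zeta (T c) (s c + Suc i))) F"
        using cycle by eventually_elim (use i in \<open>simp add: mixing_cycle_def Let_def\<close>)
      show "eventually (\<lambda>c. elimination_coeffs (\<lambda>j. am_v tp (T' c) (s c + j)) (\<lambda>j. am_q (T' c) (s c + j)) i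
          (r' c (s c + Suc i) - r' c (s c + i)) (am_zeta (T' c) (s c + Suc i))) F"
        using cycle' by eventually_elim (use i in \<open>simp add: mixing_cycle_def Let_def\<close>)
      show "comparable 1 (\<lambda>c. r c (s c + Suc i) - r c (s c + i)) (\<lambda>c. r' c (s c + Suc i) - r' c (s c + i))"
        by (intro comparable_diff r IH)
    qed (use that i IH in auto)
    have "comparable 1
        (\<lambda>c. (am_x (T c) (s c + Suc i) - a) - (am_x (T c) (s c + i) - a) - (\<Sum>j=1..i. am_zeta (T c) (s c + Suc i) j *\<^sub>R am_p (T c) (s c + j)))
        (\<lambda>c. (am_x (T' c) (s c + Suc i) - a) - (am_x (T' c) (s c + i) - a) - (\<Sum>j=1..i. am_zeta (T' c) (s c + Suc i) j *\<^sub>R am_p (T' c) (s c + j)))"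
      by (intro comparable_diff comparable_sum comparable_scaleR x z IH)
    then have p: "?p (Suc i)"
    proof (rule comparable_cong)
      show "eventually (\<lambda>c. am_p (T c) (s c + Suc i) = (am_x (T c) (s c + Suc i) - a) - (am_x (T c) (s c + i) - a) - (\<Sum>j=1..i. am_zeta (T c) (s c + Suc i) j *\<^sub>R am_p (T c) (s c + j))) F"
        using cycle by eventually_elim (use i in \<open>simp add: mixing_cycle_def Let_def\<close>)
      show "eventually (\<lambda>c. am_p (T' c) (s c + Suc i) = (am_x (T' c) (s c + Suc i) - a) - (am_x (T' c) (s c + i) - a) - (\<Sum>j=1..i. am_zeta (T' c) (s c + Suc i) j *\<^sub>R am_p (T' c) (s c + j))) F"
        using cycle' by eventually_elim (use i in \<open>simp add: mixing_cycle_def Let_def\<close>)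
    qed
    have "comparable 1
        (\<lambda>c. r c (s c + Suc i) - r c (s c + i) - (\<Sum>j=1..i. am_zeta (T c) (s c + Suc i) j *\<^sub>R am_q (T c) (s c + j)))
        (\<lambda>c. r' c (s c + Suc i) - r' c (s c + i) - (\<Sum>j=1..i. am_zeta (T' c) (s c + Suc i) j *\<^sub>R am_q (T' c) (s c + j)))"
      by (intro comparable_diff comparable_sum comparable_scaleR r z IH)
    then have q: "?q (Suc i)"
    proof (rule comparable_cong)
      show "eventually (\<lambda>c. am_q (T c) (s c + Suc i) = r c (s c + Suc i) - r c (s c + i) - (\<Sum>j=1..i. am_zeta (T c) (s c + Suc i) j *\<^sub>R am_q (T c) (s c + j))) F"
        using cycle by eventually_elim (use i in \<open>simp add: mixing_cycle_def Let_def\<close>)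
      show "eventually (\<lambda>c. am_q (T' c) (s c + Suc i) = r' c (s c + Suc i) - r' c (s c + i) - (\<Sum>j=1..i. am_zeta (T' c) (s c + Suc i) j *\<^sub>R am_q (T' c) (s c + j))) F"
        using cycle' by eventually_elim (use i in \<open>simp add: mixing_cycle_def Let_def\<close>)
    qed
    have "{1..Suc i} = insert (Suc i) {1..i}" "{1..<Suc i} = {1..i}" by auto
    then show ?case using x r p q z IH by simp
  qed
  show "?x i" "?r i" "j \<in> {1..i} \<Longrightarrow> ?p j" "j \<in> {1..i} \<Longrightarrow> ?q j" "j \<in> {1..<i} \<Longrightarrow> ?z i j"
    using main[OF \<open>i \<le> n\<close>] by auto
  show "j \<in> {1..i} \<Longrightarrow> ?G i j"
    using main[OF \<open>i \<le> n\<close>] G \<open>i \<le> n\<close> by blast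
qed

end

section \<open>Entries of the Hessenberg matrices\<close>

lemma hess_rec_carrier: "hess_rec b T k n \<in> carrier_mat n n"
  by (cases n) (simp_all add: Let_def)

text \<open>With \<open>hess_rec_last_column\<close>, a description of the matrices by columns: old columns are copied and
  extended by a subdiagonal entry, and a new one is expressed through the columns to its left in the same matrix.\<close>

lemma hess_rec_previous_columns:
  assumes "u < Suc i" and "w < i"
  shows "hess_rec b T (s + Suc i) (Suc i) $$ (u, w) =
    (if u < i then hess_rec b T (s + i) i $$ (u, w)
     else if w = i - 1 then - (1 / b (s + i) * (1 / (1 - am_Gamma T (s + i) i))) else 0)"
  using assms by (simp add: Let_def hess_bar_def)

lemma hess_rec_1:
  "hess_rec b T (Suc s) (Suc 0) $$ (0, 0) =
    1 / (1 - am_Gamma T (Suc s) 1) * (1 / b s - 1 / b (Suc s) * (am_Gamma T (Suc s) 1 + am_zeta T (Suc (Suc s)) 1))"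
  by (simp add: Let_def hess_col_def phi_vec_def)

lemma hess_rec_last_column:
  assumes "u < Suc i" and "0 < i"
  shows "hess_rec b T (s + Suc i) (Suc i) $$ (u, i) =
    1 / (1 - am_Gamma T (s + Suc i) (Suc i)) *
      (1 / b (s + i) * (if u < i then am_Gamma T (s + i) (u + 1) + am_zeta T (s + Suc i) (u + 1) else 1)
       - 1 / b (s + Suc i) * (am_Gamma T (s + Suc i) (u + 1) + am_zeta T (s + Suc i + 1) (u + 1))
       - (\<Sum>l = 0..<i. hess_rec b T (s + Suc i) (Suc i) $$ (u, l) *
            (am_Gamma T (s + i) (l + 1) + am_zeta T (s + Suc i) (l + 1) - am_Gamma T (s + Suc i) (l + 1))))"
proof -
  define Hb where "Hb = hess_bar b T (s + i) i (hess_rec b T (s + i) i)"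
  have Hb: "Hb \<in> carrier_mat (Suc i) i" by (simp add: Hb_def hess_bar_def)
  have left: "hess_rec b T (s + Suc i) (Suc i) $$ (u, l) = Hb $$ (u, l)" if "l < i" for l
    using assms that by (simp add: Let_def Hb_def)
  have "hess_rec b T (s + Suc i) (Suc i) $$ (u, i) = vec_index (hess_col b T (s + Suc i) (Suc i) Hb) u"
    using assms by (simp add: Let_def Hb_def)
  also have "\<dots> = 1 / (1 - am_Gamma T (s + Suc i) (Suc i)) *
      (1 / b (s + i) * (if u < i then am_Gamma T (s + i) (u + 1) + am_zeta T (s + Suc i) (u + 1) else 1)
       - 1 / b (s + Suc i) * (am_Gamma T (s + Suc i) (u + 1) + am_zeta T (s + Suc i + 1) (u + 1))
       - (\<Sum>l = 0..<i. Hb $$ (u, l) *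
            (am_Gamma T (s + i) (l + 1) + am_zeta T (s + Suc i) (l + 1) - am_Gamma T (s + Suc i) (l + 1))))"
    using assms Hb by (simp add: hess_col_def phi_vec_def Gamma_vec_def scalar_prod_def)
  finally show ?thesis using left by simp
qed

context small_parameter
begin

lemma comparable_hess_rec:
  assumes "0 < \<beta>" and b: "eventually (\<lambda>c. \<forall>j. \<beta> \<le> \<bar>b c j\<bar>) F"
    and G: "\<And>i j. i \<le> n \<Longrightarrow> j \<in> {1..i} \<Longrightarrow>
      comparable 0 (\<lambda>c. am_Gamma (T c) (s c + i) j) (\<lambda>c. am_Gamma (T' c) (s c + i) j)"
    and Z: "\<And>i j. i \<le> n \<Longrightarrow> j \<in> {1..i} \<Longrightarrow>
      comparable 0 (\<lambda>c. am_zeta (T c) (s c + Suc i) j) (\<lambda>c. am_zeta (T' c) (s c + Suc i) j)"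
    and "0 < \<tau>" and \<tau>: "\<And>i. i \<in> {1..n} \<Longrightarrow> eventually (\<lambda>c. \<tau> \<le> \<bar>1 - am_Gamma (T c) (s c + i) i\<bar>) F"
  shows "i \<le> n \<Longrightarrow> u < i \<Longrightarrow> w < i \<Longrightarrow>
    comparable 0 (\<lambda>c. hess_rec (b c) (T c) (s c + i) i $$ (u, w)) (\<lambda>c. hess_rec (b c) (T' c) (s c + i) i $$ (u, w))"
proof (induction i arbitrary: u w)
  case (Suc i)
  have b_inv: "comparable 0 (\<lambda>c. 1 / b c (s c + j)) (\<lambda>c. 1 / b c (s c + j))" for j
  proof (rule comparable_bounded[where B = "1 / \<beta>"])
    show "eventually (\<lambda>c. norm (1 / b c (s c + j)) \<le> 1 / \<beta>) F"
      using b by eventually_elim (use \<open>0 < \<beta>\<close> in \<open>auto intro!: divide_left_mono mult_pos_pos simp: less_le_trans[OF \<open>0 < \<beta>\<close>] simp flip: zero_less_abs_iff\<close>)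
  qed
  have G_inv: "comparable 0 (\<lambda>c. 1 / (1 - am_Gamma (T c) (s c + j) j)) (\<lambda>c. 1 / (1 - am_Gamma (T' c) (s c + j) j))"
    if "j \<in> {1..n}" for j
    using that \<tau>[OF that] G
    by (intro comparable_divide[where k = 0, OF _ _ \<open>0 < \<tau>\<close>] comparable_diff) (auto intro: comparable_const)
  have left: "comparable 0 (\<lambda>c. hess_rec (b c) (T c) (s c + Suc i) (Suc i) $$ (u, w))
      (\<lambda>c. hess_rec (b c) (T' c) (s c + Suc i) (Suc i) $$ (u, w))" if "u < Suc i" "w < i" for u w
  proof -
    have "comparable 0 (\<lambda>c. (- 1) * (1 / b c (s c + i) * (1 / (1 - am_Gamma (T c) (s c + i) i))))
        (\<lambda>c. (- 1) * (1 / b c (s c + i) * (1 / (1 - am_Gamma (T' c) (s c + i) i))))"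
      using that Suc.prems by (intro comparable_mult comparable_const b_inv G_inv) auto
    then show ?thesis
      unfolding hess_rec_previous_columns[OF that]
      using Suc.IH[of u w] Suc.prems that comparable_zero
      by (cases "u < i"; cases "w = i - 1") simp_all
  qed
  show ?case
  proof (cases "w < i")
    case True
    then show ?thesis using left Suc.prems by blast
  next
    case False
    then have w: "w = i" using Suc.prems by simp
    show ?thesis
    proof (cases "i = 0")
      case True
      have "comparable 0
          (\<lambda>c. 1 / (1 - am_Gamma (T c) (s c + 1) 1) * (1 / b c (s c + 0) - 1 / b c (s c + 1) *
             (am_Gamma (T c) (s c + 1) 1 + am_zeta (T c) (s c + Suc 1) 1)))
          (\<lambda>c. 1 / (1 - am_Gamma (T' c) (s c + 1) 1) * (1 / b c (s c + 0) - 1 / b c (s c + 1) *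
             (am_Gamma (T' c) (s c + 1) 1 + am_zeta (T' c) (s c + Suc 1) 1)))"
        using Suc.prems True
        by (intro comparable_mult comparable_diff comparable_add b_inv G_inv G Z) auto
      then show ?thesis
        using w True Suc.prems by (simp add: hess_rec_1 del: hess_rec.simps)
    next
      case False
      have phi: "comparable 0
          (\<lambda>c. if u < i then am_Gamma (T c) (s c + i) (u + 1) + am_zeta (T c) (s c + Suc i) (u + 1) else 1)
          (\<lambda>c. if u < i then am_Gamma (T' c) (s c + i) (u + 1) + am_zeta (T' c) (s c + Suc i) (u + 1) else 1)"
      proof (cases "u < i")
        case True
        then show ?thesis using Suc.prems by (simp only: if_True) (intro comparable_add G Z; simp)
      qed (simp add: comparable_const)
      have zeta: "comparable 0 (\<lambda>c. am_zeta (T c) (s c + Suc i + 1) (u + 1)) (\<lambda>c. am_zeta (T' c) (s c + Suc i + 1) (u + 1))"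
        using Z[of "Suc i" "u + 1"] Suc.prems by simp
      show ?thesis
        unfolding w hess_rec_last_column[OF \<open>u < Suc i\<close> False[unfolded neq0_conv]]
        using Suc.prems
        by (intro comparable_mult comparable_diff comparable_sum comparable_add phi zeta b_inv G_inv G Z left) auto
    qed
  qed
qed simp

end

section \<open>Norms and eigenvalues of real matrices over the complex numbers\<close>

definition cvec_norm2 :: "complex Matrix.vec \<Rightarrow> real" where
  "cvec_norm2 w = L2_set (\<lambda>i. cmod (vec_index w i)) {..<dim_vec w}"

lemma vec_norm2_mult_mat_vec_entries:
  assumes A: "A \<in> carrier_mat n n" and u: "u \<in> carrier_vec n"
    and B: "\<And>i j. i < n \<Longrightarrow> j < n \<Longrightarrow> \<bar>A $$ (i, j)\<bar> \<le> B"
  shows "vec_norm2 (A *\<^sub>v u) \<le> (real n)\<^sup>2 * B * vec_norm2 u"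
proof -
  have 1: "\<bar>vec_index (A *\<^sub>v u) i\<bar> \<le> real n * (B * vec_norm2 u)" if i: "i < n" for i
  proof -
    have "vec_index (A *\<^sub>v u) i = (\<Sum>j\<in>{0..<n}. A $$ (i, j) * vec_index u j)"
      using A u i by (auto simp: scalar_prod_def)
    also have "\<bar>\<dots>\<bar> \<le> (\<Sum>j\<in>{0..<n}. \<bar>A $$ (i, j)\<bar> * \<bar>vec_index u j\<bar>)"
      unfolding abs_mult[symmetric] by (rule sum_abs)
    also have "\<dots> \<le> (\<Sum>j\<in>{0..<n}. B * vec_norm2 u)"
    proof (intro sum_mono mult_mono)
      fix j assume j: "j \<in> {0..<n}"
      show "\<bar>A $$ (i, j)\<bar> \<le> B" using B i j by simp
      then show "0 \<le> B" by (rule order_trans[OF abs_ge_zero])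
      show "\<bar>vec_index u j\<bar> \<le> vec_norm2 u"
        using member_le_L2_set[of "{..<n}" j "\<lambda>j. \<bar>vec_index u j\<bar>"] j u
        by (simp add: vec_norm2_def L2_set_def)
    qed simp
    finally show ?thesis by simp
  qed
  have "vec_norm2 (A *\<^sub>v u) \<le> (\<Sum>i\<in>{..<n}. \<bar>vec_index (A *\<^sub>v u) i\<bar>)"
  proof -
    have "dim_vec (A *\<^sub>v u) = n" using A by simp
    then show ?thesis unfolding vec_norm2_def by (simp only: L2_set_le_sum_abs)
  qed
  also have "\<dots> \<le> (\<Sum>i\<in>{..<n}. real n * (B * vec_norm2 u))"
    using 1 by (intro sum_mono) auto
  finally show ?thesis by (simp add: power2_eq_square mult.assoc)
qed

lemma vec_norm2_smult: "vec_norm2 (a \<cdot>\<^sub>v u) = \<bar>a\<bar> * vec_norm2 u"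
proof -
  have "vec_norm2 (a \<cdot>\<^sub>v u) = L2_set (\<lambda>i. \<bar>a\<bar> * vec_index u i) {..<dim_vec u}"
    unfolding vec_norm2_def L2_set_def by (simp add: power_mult_distrib)
  also have "\<dots> = \<bar>a\<bar> * vec_norm2 u"
    unfolding vec_norm2_def by (rule L2_set_right_distrib[symmetric]) simp
  finally show ?thesis .
qed

lemma vec_norm2_eq_0: "vec_norm2 u = 0 \<Longrightarrow> u \<in> carrier_vec n \<Longrightarrow> u = 0\<^sub>v n"
  by (auto simp: vec_norm2_def L2_set_eq_0_iff)

lemma vec_norm2_unit_vec:
  assumes "i < n"
  shows "vec_norm2 (unit_vec n i) = 1"
proof -
  have "(\<Sum>j<n. (vec_index (unit_vec n i) j)\<^sup>2) = (\<Sum>j<n. if j = i then 1 else 0 :: real)"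
    by (intro sum.cong) (auto simp: unit_vec_def)
  then show ?thesis using assms by (simp add: vec_norm2_def L2_set_def)
qed

lemma entries_bounded:
  fixes A :: "real mat"
  obtains B where "\<And>i j. i < n \<Longrightarrow> j < n \<Longrightarrow> \<bar>A $$ (i, j)\<bar> \<le> B"
proof
  fix i j assume "i < n" "j < n"
  then have "\<bar>A $$ (i, j)\<bar> \<le> (\<Sum>j<n. \<bar>A $$ (i, j)\<bar>)" by (intro member_le_sum) auto
  also have "\<dots> \<le> (\<Sum>i<n. \<Sum>j<n. \<bar>A $$ (i, j)\<bar>)"
    using \<open>i < n\<close> by (intro member_le_sum[where f = "\<lambda>i. \<Sum>j<n. \<bar>A $$ (i, j)\<bar>"]) (auto intro: sum_nonneg)
  finally show "\<bar>A $$ (i, j)\<bar> \<le> (\<Sum>i<n. \<Sum>j<n. \<bar>A $$ (i, j)\<bar>)" .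
qed

lemma vec_norm2_mult_mat_vec:
  assumes A: "A \<in> carrier_mat n n" and u: "u \<in> carrier_vec n"
  shows "vec_norm2 (A *\<^sub>v u) \<le> mat_norm2 A * vec_norm2 u"
proof (cases "vec_norm2 u = 0")
  case True
  then have "u = 0\<^sub>v n" using u by (rule vec_norm2_eq_0)
  then have "A *\<^sub>v u = 0\<^sub>v n" using A by auto
  then show ?thesis using True by (simp add: vec_norm2_def L2_set_def)
next
  case False
  define t where "t = vec_norm2 u"
  have t: "0 < t" using False by (simp add: t_def vec_norm2_def less_le)
  obtain B where B: "\<And>i j. i < n \<Longrightarrow> j < n \<Longrightarrow> \<bar>A $$ (i, j)\<bar> \<le> B"
    using entries_bounded[of n A] by blast
  have "bdd_above ((\<lambda>u. vec_norm2 (A *\<^sub>v u)) ` {u \<in> carrier_vec (dim_col A). vec_norm2 u = 1})"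
  proof (rule bdd_aboveI2)
    fix u assume "u \<in> {u \<in> carrier_vec (dim_col A). vec_norm2 u = 1}"
    then show "vec_norm2 (A *\<^sub>v u) \<le> (real n)\<^sup>2 * B"
      using vec_norm2_mult_mat_vec_entries[OF A _ B, of u] A by simp
  qed
  then have "vec_norm2 (A *\<^sub>v ((1 / t) \<cdot>\<^sub>v u)) \<le> mat_norm2 A"
    unfolding mat_norm2_def
    by (rule cSUP_upper[rotated]) (use A u t in \<open>auto simp: vec_norm2_smult t_def\<close>)
  moreover have "A *\<^sub>v ((1 / t) \<cdot>\<^sub>v u) = (1 / t) \<cdot>\<^sub>v (A *\<^sub>v u)"
    using A u by (rule mult_mat_vec)
  ultimately have "1 / t * vec_norm2 (A *\<^sub>v u) \<le> mat_norm2 A"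
    using t by (simp only: vec_norm2_smult) simp
  then show ?thesis using t by (simp add: t_def field_simps)
qed

lemma mat_norm2_le_entries:
  assumes A: "A \<in> carrier_mat n n" and "0 < n"
    and B: "\<And>i j. i < n \<Longrightarrow> j < n \<Longrightarrow> \<bar>A $$ (i, j)\<bar> \<le> B"
  shows "mat_norm2 A \<le> (real n)\<^sup>2 * B"
  unfolding mat_norm2_def
proof (rule cSUP_least)
  have "vec_norm2 (unit_vec n 0) = 1" using \<open>0 < n\<close> by (rule vec_norm2_unit_vec)
  then show "{u \<in> carrier_vec (dim_col A). vec_norm2 u = 1} \<noteq> {}"
    using A by (auto intro!: exI[of _ "unit_vec n 0"])
next
  fix u assume "u \<in> {u \<in> carrier_vec (dim_col A). vec_norm2 u = 1}"
  then show "vec_norm2 (A *\<^sub>v u) \<le> (real n)\<^sup>2 * B"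
    using vec_norm2_mult_mat_vec_entries[OF A _ B, of u] A by simp
qed

lemma mat_norm2_nonneg:
  assumes "A \<in> carrier_mat n n" and "0 < n"
  shows "0 \<le> mat_norm2 A"
proof -
  have "0 \<le> vec_norm2 (A *\<^sub>v unit_vec n 0)" by (simp add: vec_norm2_def)
  also have "\<dots> \<le> mat_norm2 A * vec_norm2 (unit_vec n 0)"
    by (rule vec_norm2_mult_mat_vec[OF assms(1)]) simp
  finally show ?thesis by (simp add: vec_norm2_unit_vec[OF \<open>0 < n\<close>])
qed

text \<open>A real matrix acts separately on real and imaginary parts, and the squared norms of the parts add up. Hence the
  operator norm over the reals also bounds the action on complex vectors, which eigenvectors of real
  matrices require.\<close>

lemma cvec_norm2_mult_mat_vec:
  assumes A: "A \<in> carrier_mat n n" and "0 < n" and w: "w \<in> carrier_vec n"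
  shows "cvec_norm2 (map_mat complex_of_real A *\<^sub>v w) \<le> mat_norm2 A * cvec_norm2 w"
proof -
  have split: "(cvec_norm2 y)\<^sup>2 = (vec_norm2 (map_vec Re y))\<^sup>2 + (vec_norm2 (map_vec Im y))\<^sup>2" for y
  proof -
    have part: "(vec_norm2 (map_vec f y))\<^sup>2 = (\<Sum>i<dim_vec y. (f (vec_index y i))\<^sup>2)" for f :: "complex \<Rightarrow> real"
      by (auto simp: vec_norm2_def L2_set_def sum_nonneg intro!: sum.cong)
    have "(cvec_norm2 y)\<^sup>2 = (\<Sum>i<dim_vec y. (cmod (vec_index y i))\<^sup>2)"
      by (simp add: cvec_norm2_def L2_set_def sum_nonneg)
    then show ?thesis by (simp only: part cmod_power2 sum.distrib)
  qed
  have Re: "map_vec Re (map_mat complex_of_real A *\<^sub>v w) = A *\<^sub>v map_vec Re w"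
    and Im: "map_vec Im (map_mat complex_of_real A *\<^sub>v w) = A *\<^sub>v map_vec Im w"
    using A w by (auto simp: scalar_prod_def)
  have sq: "(vec_norm2 (A *\<^sub>v u))\<^sup>2 \<le> (mat_norm2 A)\<^sup>2 * (vec_norm2 u)\<^sup>2" if "u \<in> carrier_vec n" for u
    unfolding power_mult_distrib[symmetric]
    using vec_norm2_mult_mat_vec[OF A that] by (intro power_mono) (auto simp: vec_norm2_def)
  have "(cvec_norm2 (map_mat complex_of_real A *\<^sub>v w))\<^sup>2 \<le> (mat_norm2 A * cvec_norm2 w)\<^sup>2"
    unfolding power_mult_distrib split Re Im distrib_left
    using w by (intro add_mono sq) (auto intro!: carrier_vecI)
  then show ?thesis
    by (rule power2_le_imp_le) (simp add: mat_norm2_nonneg[OF A \<open>0 < n\<close>] cvec_norm2_def)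
qed

lemma cvec_norm2_smult: "cvec_norm2 (a \<cdot>\<^sub>v w) = cmod a * cvec_norm2 w"
proof -
  have "cvec_norm2 (a \<cdot>\<^sub>v w) = L2_set (\<lambda>i. cmod a * cmod (vec_index w i)) {..<dim_vec w}"
    unfolding cvec_norm2_def L2_set_def by (simp add: norm_mult)
  also have "\<dots> = cmod a * cvec_norm2 w"
    unfolding cvec_norm2_def by (rule L2_set_right_distrib[symmetric]) simp
  finally show ?thesis .
qed

lemma cvec_norm2_pos: "w \<in> carrier_vec n \<Longrightarrow> w \<noteq> 0\<^sub>v n \<Longrightarrow> 0 < cvec_norm2 w"
  by (auto simp: cvec_norm2_def less_le L2_set_eq_0_iff)

lemma complex_spectrum_eigenvector:
  assumes "A \<in> carrier_mat n n" and "ev \<in> complex_spectrum A"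
  obtains w where "w \<in> carrier_vec n" "w \<noteq> 0\<^sub>v n" "map_mat complex_of_real A *\<^sub>v w = ev \<cdot>\<^sub>v w"
  using assms unfolding complex_spectrum_def spectrum_def eigenvalue_def eigenvector_def by auto

lemma cmod_eigenvalue_le_mat_norm2:
  assumes A: "A \<in> carrier_mat n n" and "0 < n" and "ev \<in> complex_spectrum A"
  shows "cmod ev \<le> mat_norm2 A"
proof -
  obtain w where w: "w \<in> carrier_vec n" "w \<noteq> 0\<^sub>v n" "map_mat complex_of_real A *\<^sub>v w = ev \<cdot>\<^sub>v w"
    using complex_spectrum_eigenvector[OF A assms(3)] .
  have "cmod ev * cvec_norm2 w \<le> mat_norm2 A * cvec_norm2 w"
    using cvec_norm2_mult_mat_vec[OF A \<open>0 < n\<close> w(1)] w(3) by (simp add: cvec_norm2_smult)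
  then show ?thesis using cvec_norm2_pos[OF w(1,2)] by simp
qed

lemma complex_spectrum_finite_nonempty:
  assumes "A \<in> carrier_mat n n" and "0 < n"
  shows "finite (complex_spectrum A)" and "complex_spectrum A \<noteq> {}"
proof -
  let ?A = "map_mat complex_of_real A"
  have A: "?A \<in> carrier_mat n n" using assms by simp
  show "finite (complex_spectrum A)"
    unfolding complex_spectrum_def by (rule card_finite_spectrum(1)[OF A])
  show "complex_spectrum A \<noteq> {}"
    unfolding complex_spectrum_def using spectrum_non_empty[OF A] \<open>0 < n\<close> by auto
qed

text \<open>The modulus of the characteristic polynomial at a point is the product of its distances to the \<open>n\<close> eigenvalues, each of
  which is at least the minimum.\<close>

lemma min_distance_power_le_char_poly:
  assumes A: "A \<in> carrier_mat n n" and "0 < n"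
  shows "Min ((\<lambda>z. cmod (z - ev)) ` complex_spectrum A) ^ n
    \<le> cmod (poly (char_poly (map_mat complex_of_real A)) ev)"
proof -
  let ?A = "map_mat complex_of_real A" and ?d = "Min ((\<lambda>z. cmod (z - ev)) ` complex_spectrum A)"
  have cA: "?A \<in> carrier_mat n n" using A by simp
  obtain as where as: "char_poly ?A = (\<Prod>a\<leftarrow>as. [:- a, 1:])" "length as = n"
    using char_poly_factorized[OF cA] by blast
  have fin: "finite ((\<lambda>z. cmod (z - ev)) ` complex_spectrum A)"
    using complex_spectrum_finite_nonempty[OF assms] by simp
  have d0: "0 \<le> ?d"
    using complex_spectrum_finite_nonempty[OF assms] by simp
  have d: "?d \<le> cmod (ev - a)" if "a \<in> set as" for a
  proof -
    have "poly (char_poly ?A) a = 0"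
      using that unfolding as poly_prod_list by (auto simp: prod_list_zero_iff)
    then have "a \<in> complex_spectrum A"
      by (simp add: complex_spectrum_def spectrum_def eigenvalue_root_char_poly[OF cA])
    then have "?d \<le> cmod (a - ev)" using fin by (intro Min_le) auto
    then show ?thesis by (simp add: norm_minus_commute)
  qed
  have "?d ^ length xs \<le> cmod (poly (\<Prod>a\<leftarrow>xs. [:- a, 1:]) ev)" if "set xs \<subseteq> set as" for xs
    using that
  proof (induction xs)
    case (Cons a xs)
    then have "?d * ?d ^ length xs \<le> cmod (ev - a) * cmod (poly (\<Prod>a\<leftarrow>xs. [:- a, 1:]) ev)"
      using d d0 by (intro mult_mono) auto
    then show ?case by (simp add: norm_mult[symmetric] algebra_simps)
  qed simp
  from this[of as] show ?thesis using as by simp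
qed

text \<open>Let \<open>w\<close> be an eigenvector of \<open>A\<close> and \<open>y = M' w\<close>. Then \<open>(D - ev) y = M' (B - A) M y\<close>, where every
  diagonal entry of \<open>D - ev\<close> is the difference of \<open>ev\<close> to an eigenvalue of \<open>B\<close>.\<close>

lemma bauer_fike:
  assumes A: "A \<in> carrier_mat n n" and B: "B \<in> carrier_mat n n" and "0 < n"
    and sim: "similar_mat_wit B D M M'" and diag: "diagonal_mat D"
    and ev: "ev \<in> complex_spectrum A"
  shows "Min ((\<lambda>z. cmod (z - ev)) ` complex_spectrum B) \<le> mat_norm2 M * mat_norm2 M' * mat_norm2 (B - A)"
proof -
  let ?c = "map_mat complex_of_real" and ?d = "Min ((\<lambda>z. cmod (z - ev)) ` complex_spectrum B)"
  have fin: "finite ((\<lambda>z. cmod (z - ev)) ` complex_spectrum B)"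
    using complex_spectrum_finite_nonempty[OF B \<open>0 < n\<close>] by simp
  have d0: "0 \<le> ?d"
    using complex_spectrum_finite_nonempty[OF B \<open>0 < n\<close>] by simp
  have carr: "D \<in> carrier_mat n n" "M \<in> carrier_mat n n" "M' \<in> carrier_mat n n"
    and inv: "M * M' = 1\<^sub>m n" "M' * M = 1\<^sub>m n" and BD: "B = M * D * M'"
    using sim B by (auto simp: similar_mat_wit_def Let_def)
  have M'B: "M' * B = D * M'"
  proof -
    have "M' * (M * D * M') = (M' * M) * (D * M')"
      using carr by (simp add: assoc_mult_mat[of _ n n _ n _ n])
    then show ?thesis using BD inv carr by simp
  qed
  obtain w where w: "w \<in> carrier_vec n" "w \<noteq> 0\<^sub>v n" "?c A *\<^sub>v w = ev \<cdot>\<^sub>v w"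
    using complex_spectrum_eigenvector[OF A ev] .
  define y where "y = ?c M' *\<^sub>v w"
  have y: "y \<in> carrier_vec n" using carr w by (simp add: y_def)
  have cmult: "?c (X * Y) = ?c X * ?c Y" if "X \<in> carrier_mat n n" "Y \<in> carrier_mat n n" for X Y
    using that by (rule of_real_hom.mat_hom_mult)
  have My: "?c M *\<^sub>v y = w"
  proof -
    have "?c M *\<^sub>v y = ?c (M * M') *\<^sub>v w"
      unfolding y_def cmult[OF carr(2,3)]
      using carr w by (intro assoc_mult_mat_vec[symmetric]) auto
    also have "\<dots> = w" using w by (simp add: inv of_real_hom.mat_hom_one)
    finally show ?thesis .
  qed
  have "y \<noteq> 0\<^sub>v n"
  proof
    assume "y = 0\<^sub>v n"
    then have "w = 0\<^sub>v n" using My carr by auto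
    with w show False by simp
  qed
  define z where "z = ?c (B - A) *\<^sub>v w"
  have z: "z = ?c B *\<^sub>v w - ev \<cdot>\<^sub>v w"
  proof -
    have "?c (B - A) = ?c B - ?c A" using A B by auto
    then show ?thesis unfolding z_def w(3)[symmetric]
      using A B w by (simp add: minus_mult_distrib_mat_vec)
  qed
  have z_carr: "z \<in> carrier_vec n" unfolding z using B w by auto
  have "?c M' *\<^sub>v z = ?c M' *\<^sub>v (?c B *\<^sub>v w) - ?c M' *\<^sub>v (ev \<cdot>\<^sub>v w)"
    unfolding z using B carr w by (intro mult_minus_distrib_mat_vec) auto
  also have "?c M' *\<^sub>v (?c B *\<^sub>v w) = ?c D *\<^sub>v y"
  proof -
    have "?c M' *\<^sub>v (?c B *\<^sub>v w) = ?c (M' * B) *\<^sub>v w"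
      unfolding cmult[OF carr(3) B] using B carr w by (intro assoc_mult_mat_vec[symmetric]) auto
    also have "\<dots> = ?c D *\<^sub>v y"
      unfolding M'B cmult[OF carr(1,3)] y_def using carr w by (intro assoc_mult_mat_vec) auto
    finally show ?thesis .
  qed
  also have "?c M' *\<^sub>v (ev \<cdot>\<^sub>v w) = ev \<cdot>\<^sub>v y"
    unfolding y_def using carr w by (intro mult_mat_vec) auto
  finally have M'z: "?c M' *\<^sub>v z = ?c D *\<^sub>v y - ev \<cdot>\<^sub>v y" .
  have entry: "vec_index (?c D *\<^sub>v y - ev \<cdot>\<^sub>v y) i = (complex_of_real (D $$ (i, i)) - ev) * vec_index y i"
    if i: "i < n" for i
  proof -
    have "vec_index (?c D *\<^sub>v y) i = (\<Sum>j\<in>{0..<n}. complex_of_real (D $$ (i, j)) * vec_index y j)"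
      using carr y i by (auto simp: scalar_prod_def)
    also have "\<dots> = (\<Sum>j\<in>{0..<n}. if j = i then complex_of_real (D $$ (i, i)) * vec_index y i else 0)"
      using diag carr i by (intro sum.cong) (auto simp: diagonal_mat_def)
    also have "\<dots> = complex_of_real (D $$ (i, i)) * vec_index y i" using i by simp
    finally show ?thesis using carr y i by (simp add: algebra_simps)
  qed
  have D: "?d \<le> cmod (complex_of_real (D $$ (i, i)) - ev)" if i: "i < n" for i
  proof -
    have "char_poly B = char_poly D"
      using sim by (intro char_poly_similar) (auto simp: similar_mat_def)
    also have "\<dots> = (\<Prod>a\<leftarrow>diag_mat D. [:- a, 1:])"
      using carr diag by (intro char_poly_upper_triangular) (auto simp: diagonal_mat_def upper_triangular_def)
    finally have "poly (char_poly B) (D $$ (i, i)) = 0"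
      using i carr by (auto simp: poly_prod_list prod_list_zero_iff diag_mat_def)
    then have "eigenvalue B (D $$ (i, i))" by (simp add: eigenvalue_root_char_poly[OF B])
    then have "complex_of_real (D $$ (i, i)) \<in> complex_spectrum B"
      using of_real_hom.eigenvalue_hom[OF B] by (auto simp: complex_spectrum_def spectrum_def)
    then show ?thesis using fin by (intro Min_le) auto
  qed
  have "?d * cvec_norm2 y \<le> cvec_norm2 (?c D *\<^sub>v y - ev \<cdot>\<^sub>v y)"
  proof -
    have "?d * cvec_norm2 y = L2_set (\<lambda>i. ?d * cmod (vec_index y i)) {..<n}"
      using y d0 by (simp add: cvec_norm2_def L2_set_right_distrib)
    also have "\<dots> \<le> L2_set (\<lambda>i. cmod (vec_index (?c D *\<^sub>v y - ev \<cdot>\<^sub>v y) i)) {..<n}"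
    proof (rule L2_set_mono)
      fix i assume "i \<in> {..<n}"
      then show "?d * cmod (vec_index y i) \<le> cmod (vec_index (?c D *\<^sub>v y - ev \<cdot>\<^sub>v y) i)"
        using D by (simp only: entry lessThan_iff norm_mult) (intro mult_right_mono, auto)
    qed (use d0 in simp)
    also have "\<dots> = cvec_norm2 (?c D *\<^sub>v y - ev \<cdot>\<^sub>v y)"
      using carr y by (simp add: cvec_norm2_def)
    finally show ?thesis .
  qed
  also have "\<dots> \<le> mat_norm2 M' * cvec_norm2 z"
    unfolding M'z[symmetric] by (rule cvec_norm2_mult_mat_vec[OF carr(3) \<open>0 < n\<close> z_carr])
  also have "\<dots> \<le> mat_norm2 M' * (mat_norm2 (B - A) * cvec_norm2 w)"
    unfolding z_def using A B w \<open>0 < n\<close> carr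
    by (intro mult_left_mono cvec_norm2_mult_mat_vec mat_norm2_nonneg[of _ n]) auto
  also have "\<dots> \<le> mat_norm2 M' * (mat_norm2 (B - A) * (mat_norm2 M * cvec_norm2 y))"
    unfolding My[symmetric] using A B carr y \<open>0 < n\<close>
    by (intro mult_left_mono cvec_norm2_mult_mat_vec mat_norm2_nonneg[of _ n]) auto
  finally have "?d * cvec_norm2 y \<le> (mat_norm2 M * mat_norm2 M' * mat_norm2 (B - A)) * cvec_norm2 y"
    by (simp add: mult_ac)
  then show ?thesis using cvec_norm2_pos[OF y \<open>y \<noteq> 0\<^sub>v n\<close>] by simp
qed

context small_parameter
begin

lemma comparable_of_real:
  assumes "comparable 0 f f'"
  shows "comparable 0 (\<lambda>c. complex_of_real (f c)) (\<lambda>c. complex_of_real (f' c))"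
  using comparable_scaleR[OF assms comparable_const[of "1::complex"]] by (simp add: scaleR_conv_of_real)

text \<open>By the Leibniz formula the value is a polynomial in the entries and the point.\<close>

lemma comparable_char_poly:
  assumes A: "\<And>c. A c \<in> carrier_mat n n" and A': "\<And>c. A' c \<in> carrier_mat n n"
    and entries: "\<And>i j. i < n \<Longrightarrow> j < n \<Longrightarrow> comparable 0 (\<lambda>c. A c $$ (i, j)) (\<lambda>c. A' c $$ (i, j))"
    and z: "comparable 0 z z"
  shows "comparable 0 (\<lambda>c. poly (char_poly (map_mat complex_of_real (A c))) (z c))
    (\<lambda>c. poly (char_poly (map_mat complex_of_real (A' c))) (z c))"
proof -
  let ?m = "\<lambda>A z. - char_matrix (map_mat complex_of_real A) z"
  have expand: "poly (char_poly (map_mat complex_of_real B)) x =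
      (\<Sum>p | p permutes {0..<n}. signof p * (\<Prod>i = 0..<n. (if i = p i then x else 0) - complex_of_real (B $$ (i, p i))))"
    if B: "B \<in> carrier_mat n n" for B x
  proof -
    have "poly (char_poly (map_mat complex_of_real B)) x = Determinant.det (?m B x)"
      using B by (intro char_poly_matrix) auto
    also have "\<dots> = (\<Sum>p | p permutes {0..<n}. signof p * (\<Prod>i = 0..<n. ?m B x $$ (i, p i)))"
      using B by (intro det_def') auto
    also have "\<dots> = (\<Sum>p | p permutes {0..<n}. signof p * (\<Prod>i = 0..<n. (if i = p i then x else 0) - complex_of_real (B $$ (i, p i))))"
    proof (intro sum.cong refl arg_cong2[of _ _ _ _ "(*)"] prod.cong)
      fix p i assume "p \<in> {p. p permutes {0..<n}}" "i \<in> {0..<n}"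
      then have "i < n" "p i < n" using permutes_in_image[of p "{0..<n}" i] by auto
      then show "?m B x $$ (i, p i) = (if i = p i then x else 0) - complex_of_real (B $$ (i, p i))"
        using B by (auto simp: char_matrix_def)
    qed
    finally show ?thesis .
  qed
  have if_const: "comparable 0 (\<lambda>c. if P then z c else 0) (\<lambda>c. if P then z c else 0)" for P
    using z comparable_zero by (cases P) auto
  show ?thesis
    unfolding expand[OF A] expand[OF A']
  proof (intro comparable_sum comparable_mult comparable_const comparable_prod comparable_diff
      comparable_of_real entries if_const)
    fix p i assume "p \<in> {p. p permutes {0..<n}}" "i \<in> {0..<n}"
    then show "i < n" "p i < n" using permutes_in_image[of p "{0..<n}" i] by auto
  qed
qed

lemma comparable_entries:
  fixes A A' :: "'c \<Rightarrow> real mat"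
  assumes "\<And>i j. i < n \<Longrightarrow> j < n \<Longrightarrow> comparable 0 (\<lambda>c. A c $$ (i, j)) (\<lambda>c. A' c $$ (i, j))"
  obtains B where "eventually (\<lambda>c. \<forall>i<n. \<forall>j<n.
    \<bar>A c $$ (i, j)\<bar> \<le> B \<and> \<bar>A' c $$ (i, j) - A c $$ (i, j)\<bar> \<le> B * \<delta> c) F"
proof -
  have "\<forall>i j. \<exists>C. i < n \<longrightarrow> j < n \<longrightarrow> 0 < C \<and> eventually (\<lambda>c.
      \<bar>A c $$ (i, j)\<bar> \<le> C \<and> \<bar>A' c $$ (i, j) - A c $$ (i, j)\<bar> \<le> C * \<delta> c) F"
  proof (intro allI)
    fix i j
    show "\<exists>C. i < n \<longrightarrow> j < n \<longrightarrow> 0 < C \<and> eventually (\<lambda>c.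
        \<bar>A c $$ (i, j)\<bar> \<le> C \<and> \<bar>A' c $$ (i, j) - A c $$ (i, j)\<bar> \<le> C * \<delta> c) F"
    proof (cases "i < n \<and> j < n")
      case True
      then show ?thesis
        using assms[of i j] unfolding comparable_def by (auto simp: abs_minus_commute)
    qed auto
  qed
  then have "\<exists>C. \<forall>i j. i < n \<longrightarrow> j < n \<longrightarrow> 0 < C i j \<and> eventually (\<lambda>c.
      \<bar>A c $$ (i, j)\<bar> \<le> C i j \<and> \<bar>A' c $$ (i, j) - A c $$ (i, j)\<bar> \<le> C i j * \<delta> c) F"
    by (simp only: choice_iff)
  then obtain C where C: "\<And>i j. i < n \<Longrightarrow> j < n \<Longrightarrow> 0 < C i j \<and> eventually (\<lambda>c.
      \<bar>A c $$ (i, j)\<bar> \<le> C i j \<and> \<bar>A' c $$ (i, j) - A c $$ (i, j)\<bar> \<le> C i j * \<delta> c) F"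
    by blast
  define B where "B = (\<Sum>i<n. \<Sum>j<n. C i j)"
  have CB: "C i j \<le> B" if "i < n" "j < n" for i j
  proof -
    have "C i j \<le> (\<Sum>j<n. C i j)"
      using that C by (intro member_le_sum) (auto intro: less_imp_le)
    also have "\<dots> \<le> B"
      unfolding B_def using that C
      by (intro member_le_sum[where f = "\<lambda>i. \<Sum>j<n. C i j"]) (auto intro!: sum_nonneg intro: less_imp_le)
    finally show ?thesis .
  qed
  have "eventually (\<lambda>c. \<bar>A c $$ (i, j)\<bar> \<le> B \<and> \<bar>A' c $$ (i, j) - A c $$ (i, j)\<bar> \<le> B * \<delta> c) F"
    if "i < n" "j < n" for i j
    using C[OF that, THEN conjunct2] positive
  proof eventually_elim
    case (elim c)
    have "C i j * \<delta> c \<le> B * \<delta> c" using CB[OF that] elim by (intro mult_right_mono) auto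
    then show ?case using elim CB[OF that] by linarith
  qed
  then have "eventually (\<lambda>c. \<forall>i\<in>{..<n}. \<forall>j\<in>{..<n}.
      \<bar>A c $$ (i, j)\<bar> \<le> B \<and> \<bar>A' c $$ (i, j) - A c $$ (i, j)\<bar> \<le> B * \<delta> c) F"
    by (intro eventually_ball_finite ballI) auto
  then show ?thesis by (intro that[of B]) (simp add: lessThan_def)
qed

text \<open>The eigenvalues \<open>z\<close> of \<open>A\<close> are bounded by the entries of \<open>A\<close>, so the characteristic polynomials of \<open>A\<close> and
  \<open>A'\<close> at \<open>z\<close> are comparable; the former vanishes there.\<close>

lemma comparable_spectrum:
  assumes A: "\<And>c. A c \<in> carrier_mat n n" and A': "\<And>c. A' c \<in> carrier_mat n n" and "0 < n"
    and entries: "\<And>i j. i < n \<Longrightarrow> j < n \<Longrightarrow> comparable 0 (\<lambda>c. A c $$ (i, j)) (\<lambda>c. A' c $$ (i, j))"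
    and z: "eventually (\<lambda>c. z c \<in> complex_spectrum (A c)) F"
  shows "\<exists>C>0. eventually (\<lambda>c.
      Min ((\<lambda>y. cmod (y - z c)) ` complex_spectrum (A' c)) ^ n \<le> C * \<delta> c \<and>
      mat_norm2 (A' c - A c) \<le> C * \<delta> c) F"
proof -
  obtain B where B: "eventually (\<lambda>c. \<forall>i<n. \<forall>j<n.
      \<bar>A c $$ (i, j)\<bar> \<le> B \<and> \<bar>A' c $$ (i, j) - A c $$ (i, j)\<bar> \<le> B * \<delta> c) F"
    using comparable_entries[of n A A'] entries by blast
  have "eventually (\<lambda>c. cmod (z c) \<le> (real n)\<^sup>2 * B) F"
    using B z
  proof eventually_elim
    case (elim c)
    have "cmod (z c) \<le> mat_norm2 (A c)"
      using elim by (intro cmod_eigenvalue_le_mat_norm2[OF A \<open>0 < n\<close>])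
    also have "\<dots> \<le> (real n)\<^sup>2 * B"
      using elim by (intro mat_norm2_le_entries[OF A \<open>0 < n\<close>]) auto
    finally show ?case .
  qed
  then have "comparable 0 z z" by (rule comparable_bounded)
  from comparable_char_poly[OF A A' entries this]
  obtain C where "0 < C" and C: "eventually (\<lambda>c.
      norm (poly (char_poly (map_mat complex_of_real (A c))) (z c)) \<le> C * \<delta> c ^ 0 \<and>
      norm (poly (char_poly (map_mat complex_of_real (A c))) (z c) -
        poly (char_poly (map_mat complex_of_real (A' c))) (z c)) \<le> C * \<delta> c ^ Suc 0) F"
    by (rule comparableE)
  have "eventually (\<lambda>c.
      Min ((\<lambda>y. cmod (y - z c)) ` complex_spectrum (A' c)) ^ n \<le> max C ((real n)\<^sup>2 * B) * \<delta> c \<and>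
      mat_norm2 (A' c - A c) \<le> max C ((real n)\<^sup>2 * B) * \<delta> c) F"
    using B C z positive
  proof eventually_elim
    case (elim c)
    have "map_mat complex_of_real (A c) \<in> carrier_mat n n" using A by simp
    from eigenvalue_root_char_poly[OF this]
    have "poly (char_poly (map_mat complex_of_real (A c))) (z c) = 0"
      using elim by (simp add: complex_spectrum_def spectrum_def)
    then have "cmod (poly (char_poly (map_mat complex_of_real (A' c))) (z c)) \<le> C * \<delta> c"
      using elim by simp
    also have "\<dots> \<le> max C ((real n)\<^sup>2 * B) * \<delta> c"
      using elim by (intro mult_right_mono) auto
    finally have 1: "Min ((\<lambda>y. cmod (y - z c)) ` complex_spectrum (A' c)) ^ n \<le> max C ((real n)\<^sup>2 * B) * \<delta> c"
      using min_distance_power_le_char_poly[OF A' \<open>0 < n\<close>] order_trans by blast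
    have "A' c - A c \<in> carrier_mat n n" by (rule minus_carrier_mat[OF A])
    then have "mat_norm2 (A' c - A c) \<le> (real n)\<^sup>2 * (B * \<delta> c)"
      using elim A[of c] A'[of c] by (intro mat_norm2_le_entries \<open>0 < n\<close>) auto
    also have "\<dots> = ((real n)\<^sup>2 * B) * \<delta> c" by simp
    also have "\<dots> \<le> max C ((real n)\<^sup>2 * B) * \<delta> c"
      using elim by (intro mult_right_mono) auto
    finally show ?case using 1 by simp
  qed
  moreover have "0 < max C ((real n)\<^sup>2 * B)" using \<open>0 < C\<close> by simp
  ultimately show ?thesis by blast
qed

end

section \<open>Local properties of the map and of the two processes\<close>

locale mixing_problem =
  fixes g h :: "real ^ 'd \<Rightarrow> real ^ 'd" and xs :: "real ^ 'd"
    and \<rho> \<kappa> \<mu> L \<tau> \<eta> \<beta> \<beta>' :: real and m :: nat and tp :: am_type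
  assumes h_def: "\<And>x. h x = x - g x"
    and h_xs: "h xs = 0"
    and constants: "assumption_H_constants h xs \<rho> \<kappa> \<mu> L"
    and \<tau>_pos: "0 < \<tau>" and \<beta>_pos: "0 < \<beta>"
begin

definition A :: "real ^ 'd ^ 'd" where "A = jacobian h (at xs)"

definition residual :: "(real ^ 'd) am_run \<Rightarrow> nat \<Rightarrow> real ^ 'd" where
  "residual T j = g (am_x T j) - am_x T j"

definition linear_residual :: "(real ^ 'd) am_run \<Rightarrow> nat \<Rightarrow> real ^ 'd" where
  "linear_residual T j = - (A *v (am_x T j - xs))"

lemma residual_eq: "residual T j = - h (am_x T j)"
  by (simp add: residual_def h_def)

lemma pos: "0 < \<rho>" "0 < \<kappa>" "0 < \<mu>" "0 < L"
  using constants by (auto simp: assumption_H_constants_def)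

lemma has_derivative_h:
  "x \<in> cball xs \<rho> \<Longrightarrow> (h has_derivative (\<lambda>y. jacobian h (at x) *v y)) (at x)"
  using constants jacobian_works[of h "at x"] by (auto simp: assumption_H_constants_def)

lemma jacobian_bound: "x \<in> cball xs \<rho> \<Longrightarrow> norm (jacobian h (at x) *v y) \<le> L * norm y"
  and jacobian_coercive: "x \<in> cball xs \<rho> \<Longrightarrow> \<mu> * (norm y)\<^sup>2 \<le> y \<bullet> (jacobian h (at x) *v y)"
  and linearization_error:
    "x \<in> cball xs \<rho> \<Longrightarrow> norm (h x - A *v (x - xs)) \<le> 1 / 2 * \<kappa> * (norm (x - xs))\<^sup>2"
  using constants by (auto simp: assumption_H_constants_def A_def)

lemma A_bound: "norm (A *v y) \<le> L * norm y"
  using jacobian_bound[of xs] pos by (simp add: A_def)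

lemma h_upper:
  assumes "x \<in> cball xs \<rho>"
  shows "norm (h x) \<le> L * norm (x - xs)"
proof -
  have "norm (h x - h xs) \<le> L * norm (x - xs)"
  proof (rule differentiable_bound[where S = "cball xs \<rho>" and f' = "\<lambda>x y. jacobian h (at x) *v y"])
    show "onorm ((*v) (jacobian h (at y))) \<le> L" if "y \<in> cball xs \<rho>" for y
      by (rule onorm_bound) (use pos jacobian_bound that in auto)
  qed (use assms pos has_derivative_h in \<open>auto intro: has_derivative_at_withinI\<close>)
  then show ?thesis by (simp add: h_xs)
qed

text \<open>The mean value theorem for the component of \<open>h\<close> in direction \<open>x - y\<close> along the segment from \<open>y\<close> to \<open>x\<close>.\<close>

lemma h_strongly_monotone:
  assumes "x \<in> cball xs \<rho>" and "y \<in> cball xs \<rho>"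
  shows "\<mu> * (norm (x - y))\<^sup>2 \<le> (x - y) \<bullet> (h x - h y)"
proof -
  define w where "w = x - y"
  have in_ball: "y + t *\<^sub>R w \<in> cball xs \<rho>" if "0 \<le> t" "t \<le> 1" for t
  proof -
    have "y + t *\<^sub>R w = (1 - t) *\<^sub>R y + t *\<^sub>R x" by (simp add: w_def algebra_simps)
    then show ?thesis using convexD_alt[OF convex_cball assms(2,1) that] by simp
  qed
  have "DERIV (\<lambda>t. w \<bullet> h (y + t *\<^sub>R w)) t :> w \<bullet> (jacobian h (at (y + t *\<^sub>R w)) *v w)"
    if "0 \<le> t" "t \<le> 1" for t
  proof -
    have "((\<lambda>t. h (y + t *\<^sub>R w)) has_derivative (\<lambda>s. jacobian h (at (y + t *\<^sub>R w)) *v (s *\<^sub>R w))) (at t)"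
      by (rule has_derivative_compose[where f = "\<lambda>t. y + t *\<^sub>R w", OF _ has_derivative_h[OF in_ball[OF that]]])
        (auto intro!: derivative_eq_intros)
    then have "((\<lambda>t. w \<bullet> h (y + t *\<^sub>R w)) has_derivative
        (\<lambda>s. w \<bullet> (jacobian h (at (y + t *\<^sub>R w)) *v (s *\<^sub>R w)))) (at t)"
      by (rule has_derivative_inner_right)
    moreover have "(\<lambda>s. w \<bullet> (jacobian h (at (y + t *\<^sub>R w)) *v (s *\<^sub>R w))) =
        (*) (w \<bullet> (jacobian h (at (y + t *\<^sub>R w)) *v w))"
      by (simp add: fun_eq_iff matrix_vector_mult_scaleR)
    ultimately show ?thesis by (simp only: has_field_derivative_def)
  qed
  from MVT2[of 0 1, OF _ this] obtain t where t: "0 < t" "t < 1"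
    and eq: "w \<bullet> h (y + 1 *\<^sub>R w) - w \<bullet> h (y + 0 *\<^sub>R w) = (1 - 0) * (w \<bullet> (jacobian h (at (y + t *\<^sub>R w)) *v w))"
    by auto
  have "\<mu> * (norm w)\<^sup>2 \<le> w \<bullet> (jacobian h (at (y + t *\<^sub>R w)) *v w)"
    using in_ball t by (intro jacobian_coercive) auto
  also have "\<dots> = w \<bullet> (h x - h y)"
    using eq by (simp add: w_def inner_diff_right)
  finally show ?thesis unfolding w_def .
qed

lemma h_expansive:
  assumes "x \<in> cball xs \<rho>" and "y \<in> cball xs \<rho>"
  shows "\<mu> * norm (x - y) \<le> norm (h x - h y)"
proof (cases "x = y")
  case False
  have "\<mu> * (norm (x - y))\<^sup>2 \<le> norm (x - y) * norm (h x - h y)"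
    using h_strongly_monotone[OF assms] norm_cauchy_schwarz[of "x - y" "h x - h y"] by linarith
  then show ?thesis using False by (simp add: power2_eq_square)
qed simp

lemma h_lower: "x \<in> cball xs \<rho> \<Longrightarrow> \<mu> * norm (x - xs) \<le> norm (h x)"
  using h_expansive[of x xs] pos by (simp add: h_xs)

definition admissible :: "(nat \<Rightarrow> real) \<Rightarrow> (real ^ 'd) am_run \<Rightarrow> nat \<Rightarrow> bool" where
  "admissible b T K \<longleftrightarrow> restarted_AM tp g m \<tau> \<eta> b T K \<and> (\<forall>j. \<beta> \<le> \<bar>b j\<bar> \<and> \<bar>b j\<bar> \<le> \<beta>')"

abbreviation v where "v \<equiv> am_v tp"

text \<open>A positive final value of \<open>m\<^sub>k\<close> means that neither restart test succeeded. Then all intermediate values of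
  \<open>m\<^sub>k\<close> agree with the final one, which resolves the case distinctions of the iteration.\<close>

lemma iteration:
  assumes "admissible b T K" and "k \<le> K"
  defines "n \<equiv> am_m T k"
  shows "0 < n \<Longrightarrow> 0 < k \<and> n = am_m T (k - 1) + 1 \<and> n \<le> m \<and>
      successive_coeffs (v T) (am_q T) (k - n) (n - 1) (residual T k - residual T (k - 1)) (am_zeta T k) \<and>
      am_p T k = am_x T k - am_x T (k - 1) - (\<Sum>j=1..n-1. am_zeta T k j *\<^sub>R am_p T (k - n + j)) \<and>
      am_q T k = residual T k - residual T (k - 1) - (\<Sum>j=1..n-1. am_zeta T k j *\<^sub>R am_q T (k - n + j)) \<and>
      \<tau> * \<bar>v T (k - n + 1) \<bullet> am_q T (k - n + 1)\<bar> \<le> \<bar>v T k \<bullet> am_q T k\<bar>"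
    and "successive_coeffs (v T) (am_q T) (k - n) n (residual T k) (am_Gamma T k)"
    and "am_x T (k + 1) = (am_x T k - (\<Sum>j=1..n. am_Gamma T k j *\<^sub>R am_p T (k - n + j))) +
      b k *\<^sub>R (residual T k - (\<Sum>j=1..n. am_Gamma T k j *\<^sub>R am_q T (k - n + j)))"
    and "am_x T k \<noteq> xs"
proof -
  have it: "am_iteration tp g m \<tau> \<eta> b T k" and ne: "g (am_x T k) - am_x T k \<noteq> 0"
    using assms by (auto simp: admissible_def restarted_AM_def)
  show "am_x T k \<noteq> xs" using ne h_xs h_def[of xs] by auto
  show "successive_coeffs (v T) (am_q T) (k - n) n (residual T k) (am_Gamma T k)"
    and "am_x T (k + 1) = (am_x T k - (\<Sum>j=1..n. am_Gamma T k j *\<^sub>R am_p T (k - n + j))) +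
      b k *\<^sub>R (residual T k - (\<Sum>j=1..n. am_Gamma T k j *\<^sub>R am_q T (k - n + j)))"
    using it unfolding am_iteration_def Let_def n_def residual_def by blast+
  assume "0 < n"
  define m0 where "m0 = (if k = 0 then 0 else am_m T (k - 1) + 1)"
  define m1 where "m1 = (if m0 > m \<or> norm (residual T k) > \<eta> * norm (residual T (k - m0)) then 0 else m0)"
  have upd: "m1 > 0 \<longrightarrow>
      successive_coeffs (v T) (am_q T) (k - m1) (m1 - 1) (residual T k - residual T (k - 1)) (am_zeta T k) \<and>
      am_p T k = am_x T k - am_x T (k - 1) - (\<Sum>j=1..m1-1. am_zeta T k j *\<^sub>R am_p T (k - m1 + j)) \<and>
      am_q T k = residual T k - residual T (k - 1) - (\<Sum>j=1..m1-1. am_zeta T k j *\<^sub>R am_q T (k - m1 + j))"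
    and n: "n = (if m1 > 0 \<and> \<bar>v T k \<bullet> am_q T k\<bar> < \<tau> * \<bar>v T (k - m1 + 1) \<bullet> am_q T (k - m1 + 1)\<bar> then 0 else m1)"
    using it unfolding am_iteration_def Let_def n_def residual_def m0_def m1_def by blast+
  have "n = m1" and \<tau>: "\<not> \<bar>v T k \<bullet> am_q T k\<bar> < \<tau> * \<bar>v T (k - m1 + 1) \<bullet> am_q T (k - m1 + 1)\<bar>"
    using n \<open>0 < n\<close> by (auto split: if_split_asm)
  moreover have "m1 = m0" "m0 \<le> m"
    using \<open>0 < n\<close> \<open>n = m1\<close> unfolding m1_def by (auto split: if_split_asm)
  moreover have "0 < k" "m0 = am_m T (k - 1) + 1"
    using \<open>0 < n\<close> \<open>n = m1\<close> \<open>m1 = m0\<close> unfolding m0_def by (auto split: if_split_asm)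
  ultimately show "0 < k \<and> n = am_m T (k - 1) + 1 \<and> n \<le> m \<and>
      successive_coeffs (v T) (am_q T) (k - n) (n - 1) (residual T k - residual T (k - 1)) (am_zeta T k) \<and>
      am_p T k = am_x T k - am_x T (k - 1) - (\<Sum>j=1..n-1. am_zeta T k j *\<^sub>R am_p T (k - n + j)) \<and>
      am_q T k = residual T k - residual T (k - 1) - (\<Sum>j=1..n-1. am_zeta T k j *\<^sub>R am_q T (k - n + j)) \<and>
      \<tau> * \<bar>v T (k - n + 1) \<bullet> am_q T (k - n + 1)\<bar> \<le> \<bar>v T k \<bullet> am_q T k\<bar>"
    using upd \<open>0 < n\<close> by (metis not_less)
qed

lemma cycle_index:
  assumes "admissible b T K" and "k \<le> K"
  shows "am_m T k \<le> k \<and> am_m T k \<le> m \<and> (\<forall>i\<le>am_m T k. am_m T (k - am_m T k + i) = i)"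
  using assms(2)
proof (induction k)
  case 0
  then show ?case using iteration(1)[OF assms(1), of 0] by fastforce
next
  case (Suc k)
  show ?case
  proof (cases "am_m T (Suc k) = 0")
    case False
    then have n: "am_m T (Suc k) = Suc (am_m T k)" "am_m T (Suc k) \<le> m"
      using iteration(1)[OF assms(1) Suc.prems] by simp_all
    have IH: "am_m T k \<le> k" "\<forall>i\<le>am_m T k. am_m T (k - am_m T k + i) = i"
      using Suc by auto
    have "am_m T (k - am_m T k + i) = i" if "i \<le> Suc (am_m T k)" for i
      using that IH n by (cases "i = Suc (am_m T k)") auto
    then show ?thesis using n IH by simp
  qed auto
qed

text \<open>Nonzero denominators are what makes the successive quotients satisfy the orthogonality relations, since
  division by zero yields zero.\<close>

lemma restarted_cycle:
  assumes adm: "admissible b T K" and "k \<le> K" and "n = am_m T k" and "s = k - n"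
    and nz: "\<And>j. j \<in> {1..n} \<Longrightarrow> v T (s + j) \<bullet> am_q T (s + j) \<noteq> 0"
  shows "mixing_cycle tp b (residual T) T s n"
proof -
  have idx: "n \<le> k" "\<And>i. i \<le> n \<Longrightarrow> am_m T (s + i) = i"
    using cycle_index[OF adm \<open>k \<le> K\<close>] assms(3,4) by auto
  have el: "elimination_coeffs (\<lambda>j. v T (s + j)) (\<lambda>j. am_q T (s + j)) i a z"
    if "successive_coeffs (v T) (am_q T) s i a z" "i \<le> n" for i a z
  proof -
    have "elimination_coeffs (\<lambda>j. v T (s + j)) (\<lambda>j. am_q T (s + j)) i a z \<longleftrightarrow>
        (\<forall>j\<in>{1..i}. z j = (v T (s + j) \<bullet> (a - (\<Sum>l=1..<j. z l *\<^sub>R am_q T (s + l)))) / (v T (s + j) \<bullet> am_q T (s + j)))"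
      by (rule elimination_coeffs_iff) (use nz that(2) in auto)
    then show ?thesis using that(1) unfolding successive_coeffs_def by blast
  qed
  show ?thesis
    unfolding mixing_cycle_def Let_def
  proof (intro conjI allI impI)
    fix i assume "i < n"
    have le: "s + Suc i \<le> K" "s + i \<le> K" using \<open>i < n\<close> idx(1) assms(2,4) by linarith+
    have m: "am_m T (s + i) = i" "am_m T (s + Suc i) = Suc i" using idx(2)[of i] idx(2)[of "Suc i"] \<open>i < n\<close> by simp_all
    note it = iteration(1)[OF adm le(1), unfolded m] iteration(3)[OF adm le(2), unfolded m]
    show "am_x T (s + Suc i) = am_x T (s + i) - (\<Sum>j=1..i. am_Gamma T (s + i) j *\<^sub>R am_p T (s + j)) +
        b (s + i) *\<^sub>R (residual T (s + i) - (\<Sum>j=1..i. am_Gamma T (s + i) j *\<^sub>R am_q T (s + j)))"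
      using it(2) by simp
    show "am_p T (s + Suc i) = am_x T (s + Suc i) - am_x T (s + i) -
        (\<Sum>j=1..i. am_zeta T (s + Suc i) j *\<^sub>R am_p T (s + j))"
      using it(1) by (simp add: m)
    show "am_q T (s + Suc i) = residual T (s + Suc i) - residual T (s + i) -
        (\<Sum>j=1..i. am_zeta T (s + Suc i) j *\<^sub>R am_q T (s + j))"
      using it(1) by (simp add: m)
    show "elimination_coeffs (\<lambda>j. v T (s + j)) (\<lambda>j. am_q T (s + j)) i
        (residual T (s + Suc i) - residual T (s + i)) (am_zeta T (s + Suc i))"
      using it(1) \<open>i < n\<close> by (intro el) (simp_all add: m)
  next
    fix i assume "i \<le> n"
    then have "s + i \<le> K" using idx(1) assms(2,4) by linarith
    then show "elimination_coeffs (\<lambda>j. v T (s + j)) (\<lambda>j. am_q T (s + j)) i (residual T (s + i)) (am_Gamma T (s + i))"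
      using iteration(2)[OF adm, of "s + i"] \<open>i \<le> n\<close> by (intro el) (simp_all add: idx(2))
  qed
qed

text \<open>The factors belong to the restart test (1 for the first iteration of a cycle), to the monotonicity
  of \<open>h\<close> (for Type-I and Type-II), and to the length of the first step \<open>\<beta>\<^sub>s r\<^sub>s\<close> of a cycle.\<close>

definition den_const :: real where "den_const = min 1 \<tau> * min \<mu> (\<mu>\<^sup>2) * (\<beta> * \<mu>)\<^sup>2"

lemma den_const_pos: "0 < den_const"
  using pos \<tau>_pos \<beta>_pos by (simp add: den_const_def)

text \<open>In the first iteration of a cycle \<open>p\<close> and \<open>q\<close> are the plain increments of \<open>x\<close> and \<open>-h\<close>, so that strong
  monotonicity bounds \<open>v \<bullet> q\<close> by the square of the step, and the step is \<open>\<beta>\<^sub>s r\<^sub>s\<close>. Later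
  denominators are at least \<open>\<tau>\<close> times the first one, for otherwise the cycle would have ended.\<close>

lemma denominator_bound:
  assumes adm: "admissible b T K" and "k \<le> K" and "n = am_m T k" and "s = k - n"
    and ball: "\<And>j. j \<le> k \<Longrightarrow> am_x T j \<in> cball xs \<rho>" and "j \<in> {1..n}"
  shows "den_const * (norm (am_x T s - xs))\<^sup>2 \<le> \<bar>v T (s + j) \<bullet> am_q T (s + j)\<bar>"
proof -
  have idx: "n \<le> k" "\<And>i. i \<le> n \<Longrightarrow> am_m T (s + i) = i"
    using cycle_index[OF adm \<open>k \<le> K\<close>] assms(3,4) by auto
  have "1 \<le> n" using \<open>j \<in> {1..n}\<close> by simp
  then have le: "s + 1 \<le> K" "s \<le> K" "s + j \<le> K" "s + 1 \<le> k" "s \<le> k"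
    using idx(1) assms(2,4,6) by auto
  define d where "d = am_x T (s + 1) - am_x T s"
  have p: "am_p T (s + 1) = d" and q: "am_q T (s + 1) = - (h (am_x T (s + 1)) - h (am_x T s))"
    using iteration(1)[OF adm le(1)] idx(2)[OF \<open>1 \<le> n\<close>] by (simp_all add: residual_eq d_def)
  have "d = b s *\<^sub>R residual T s"
    using iteration(3)[OF adm le(2)] idx(2)[of 0] by (simp add: d_def)
  moreover have "\<mu> * norm (am_x T s - xs) \<le> norm (residual T s)"
    using h_lower ball le by (simp add: residual_eq)
  moreover have "\<beta> \<le> \<bar>b s\<bar>" using adm by (simp add: admissible_def)
  ultimately have "\<beta> * (\<mu> * norm (am_x T s - xs)) \<le> norm d"
    using pos \<beta>_pos by (auto intro!: mult_mono)
  then have "(\<beta> * (\<mu> * norm (am_x T s - xs)))\<^sup>2 \<le> (norm d)\<^sup>2"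
    using pos \<beta>_pos by (intro power_mono) auto
  then have d: "(\<beta> * \<mu>)\<^sup>2 * (norm (am_x T s - xs))\<^sup>2 \<le> (norm d)\<^sup>2"
    by (simp add: power_mult_distrib)
  have x: "am_x T (s + 1) \<in> cball xs \<rho>" "am_x T s \<in> cball xs \<rho>" using ball le by auto
  have "min \<mu> (\<mu>\<^sup>2) * (norm d)\<^sup>2 \<le> \<bar>v T (s + 1) \<bullet> am_q T (s + 1)\<bar>"
  proof (cases tp)
    case Type_I
    have "min \<mu> (\<mu>\<^sup>2) * (norm d)\<^sup>2 \<le> \<mu> * (norm d)\<^sup>2" by (intro mult_right_mono) auto
    also have "\<dots> \<le> d \<bullet> (h (am_x T (s + 1)) - h (am_x T s))"
      using h_strongly_monotone[OF x] by (simp add: d_def)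
    also have "\<dots> \<le> \<bar>v T (s + 1) \<bullet> am_q T (s + 1)\<bar>"
    proof -
      have v: "v T (s + 1) = d" using p Type_I by (simp add: am_v_def)
      show ?thesis unfolding v q inner_minus_right abs_minus_cancel by (rule abs_ge_self)
    qed
    finally show ?thesis .
  next
    case Type_II
    have "min \<mu> (\<mu>\<^sup>2) * (norm d)\<^sup>2 \<le> (\<mu> * norm d)\<^sup>2"
      unfolding power_mult_distrib by (intro mult_right_mono) auto
    also have "\<dots> \<le> (norm (am_q T (s + 1)))\<^sup>2"
      unfolding q norm_minus_cancel using h_expansive[OF x] pos by (intro power_mono) (auto simp: d_def)
    also have "\<dots> = \<bar>v T (s + 1) \<bullet> am_q T (s + 1)\<bar>"
      using Type_II by (simp add: am_v_def power2_norm_eq_inner)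
    finally show ?thesis .
  qed
  moreover have "min \<mu> (\<mu>\<^sup>2) * ((\<beta> * \<mu>)\<^sup>2 * (norm (am_x T s - xs))\<^sup>2) \<le> min \<mu> (\<mu>\<^sup>2) * (norm d)\<^sup>2"
    using d pos by (intro mult_left_mono) auto
  ultimately have 1: "min \<mu> (\<mu>\<^sup>2) * ((\<beta> * \<mu>)\<^sup>2 * (norm (am_x T s - xs))\<^sup>2) \<le> \<bar>v T (s + 1) \<bullet> am_q T (s + 1)\<bar>"
    by linarith
  have "den_const * (norm (am_x T s - xs))\<^sup>2 = min 1 \<tau> * (min \<mu> (\<mu>\<^sup>2) * ((\<beta> * \<mu>)\<^sup>2 * (norm (am_x T s - xs))\<^sup>2))"
    by (simp add: den_const_def mult.assoc)
  also have "\<dots> \<le> \<tau> * \<bar>v T (s + 1) \<bullet> am_q T (s + 1)\<bar>"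
    using 1 \<tau>_pos pos by (intro mult_mono) auto
  also have "\<dots> \<le> \<bar>v T (s + j) \<bullet> am_q T (s + j)\<bar>"
  proof -
    have m: "am_m T (s + j) = j" using idx(2) \<open>j \<in> {1..n}\<close> by simp
    then have "0 < am_m T (s + j)" using \<open>j \<in> {1..n}\<close> by simp
    then have "\<tau> * \<bar>v T (s + j - am_m T (s + j) + 1) \<bullet> am_q T (s + j - am_m T (s + j) + 1)\<bar> \<le> \<bar>v T (s + j) \<bullet> am_q T (s + j)\<bar>"
      using iteration(1)[OF adm le(3)] by blast
    then show ?thesis by (simp add: m)
  qed
  finally show ?thesis .
qed

text \<open>Each \<open>q\<close> is orthogonal to all earlier \<open>v\<close> of the cycle, so the projection conditions on whole spans reduce to
  conditions after each single step.\<close>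

lemma linearized_cycle:
  assumes adm: "admissible b T K" and lin: "linearized_AM tp A xs b T Th K"
    and "k \<le> K" and "n = am_m T k" and "s = k - n"
  shows "mixing_cycle tp b (linear_residual Th) Th s n" and "am_x Th s = am_x T s"
proof -
  have idx: "n \<le> k" "\<And>i. i \<le> n \<Longrightarrow> am_m T (s + i) = i"
    using cycle_index[OF adm \<open>k \<le> K\<close>] assms(4,5) by auto
  have le: "s + i \<le> K" if "i \<le> n" for i using that idx(1) assms(3,5) by linarith
  note lin' = lin[unfolded linearized_AM_def Let_def, folded linear_residual_def, THEN conjunct2, rule_format]
  show "am_x Th s = am_x T s"
    using lin'[OF le[of 0]] idx(2)[of 0] by simp
  have inc: "am_p Th (s + Suc i) = am_x Th (s + Suc i) - am_x Th (s + i) -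
        (\<Sum>j=1..i. am_zeta Th (s + Suc i) j *\<^sub>R am_p Th (s + j)) \<and>
      am_q Th (s + Suc i) = linear_residual Th (s + Suc i) - linear_residual Th (s + i) -
        (\<Sum>j=1..i. am_zeta Th (s + Suc i) j *\<^sub>R am_q Th (s + j))" if "i < n" for i
  proof -
    have m: "am_m T (s + Suc i) = Suc i" using idx(2)[of "Suc i"] that by simp
    have "s + Suc i \<le> K" using that by (intro le) simp
    note l = lin'[OF this, unfolded m]
    show ?thesis
    proof (cases "i = 0")
      case True
      then show ?thesis using l by simp
    next
      case False
      then have "2 \<le> Suc i" by simp
      then show ?thesis using l by simp
    qed
  qed
  have tri: "v Th (s + j) \<bullet> am_q Th (s + l) = 0" if "1 \<le> j" "j < l" "l \<le> n" for j l
  proof -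
    have m: "am_m T (s + l) = l" and "2 \<le> l" using idx(2) that by auto
    have "\<forall>w\<in>span (v Th ` {s + l - l + 1..s + l - 1}). am_q Th (s + l) \<bullet> w = 0"
      using lin'[OF le[OF that(3)], unfolded m] \<open>2 \<le> l\<close> by blast
    moreover have "v Th (s + j) \<in> span (v Th ` {s + l - l + 1..s + l - 1})"
      using that by (intro span_base imageI) auto
    ultimately have "am_q Th (s + l) \<bullet> v Th (s + j) = 0" by blast
    then show ?thesis by (simp add: inner_commute)
  qed
  show "mixing_cycle tp b (linear_residual Th) Th s n"
    unfolding mixing_cycle_def Let_def
  proof (intro conjI allI impI)
    fix i assume "i < n"
    then have m: "am_m T (s + i) = i" "am_m T (s + i + 1) = Suc i"
      using idx(2)[of i] idx(2)[of "Suc i"] by auto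
    have lt: "s + i \<le> K" "s + i < K" using le[of "Suc i"] \<open>i < n\<close> by auto
    have "am_x Th (s + i + 1) = am_x Th (s + i) + b (s + i) *\<^sub>R linear_residual Th (s + i) -
        (\<Sum>j=1..i. am_Gamma Th (s + i) j *\<^sub>R (am_p Th (s + j) + b (s + i) *\<^sub>R am_q Th (s + j)))"
      using lin'[OF lt(1), unfolded m] lt(2) by simp
    then show "am_x Th (s + Suc i) = am_x Th (s + i) - (\<Sum>j=1..i. am_Gamma Th (s + i) j *\<^sub>R am_p Th (s + j)) +
        b (s + i) *\<^sub>R (linear_residual Th (s + i) - (\<Sum>j=1..i. am_Gamma Th (s + i) j *\<^sub>R am_q Th (s + j)))"
      by (simp add: scaleR_right_distrib scaleR_right_diff_distrib sum.distrib scaleR_sum_right mult.commute)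
    show "am_p Th (s + Suc i) = am_x Th (s + Suc i) - am_x Th (s + i) -
        (\<Sum>j=1..i. am_zeta Th (s + Suc i) j *\<^sub>R am_p Th (s + j))"
      and q: "am_q Th (s + Suc i) = linear_residual Th (s + Suc i) - linear_residual Th (s + i) -
        (\<Sum>j=1..i. am_zeta Th (s + Suc i) j *\<^sub>R am_q Th (s + j))"
      using inc[OF \<open>i < n\<close>] by blast+
    show "elimination_coeffs (\<lambda>j. v Th (s + j)) (\<lambda>j. am_q Th (s + j)) i
        (linear_residual Th (s + Suc i) - linear_residual Th (s + i)) (am_zeta Th (s + Suc i))"
    proof (rule elimination_coeffs_of_orthogonal)
      fix j assume "j \<in> {1..i}"
      then show "v Th (s + j) \<bullet> (linear_residual Th (s + Suc i) - linear_residual Th (s + i) -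
          (\<Sum>l=1..i. am_zeta Th (s + Suc i) l *\<^sub>R am_q Th (s + l))) = 0"
        unfolding q[symmetric] using tri[of j "Suc i"] \<open>i < n\<close> by simp
    qed (use tri \<open>i < n\<close> in auto)
  next
    fix i assume "i \<le> n"
    then have m: "am_m T (s + i) = i" by (rule idx(2))
    show "elimination_coeffs (\<lambda>j. v Th (s + j)) (\<lambda>j. am_q Th (s + j)) i
        (linear_residual Th (s + i)) (am_Gamma Th (s + i))"
    proof (rule elimination_coeffs_of_orthogonal)
      fix j assume j: "j \<in> {1..i}"
      then have "0 < i" by simp
      then have "\<forall>w\<in>span (v Th ` {s + i - i + 1..s + i}).
          (linear_residual Th (s + i) - (\<Sum>j=1..i. am_Gamma Th (s + i) j *\<^sub>R am_q Th (s + i - i + j))) \<bullet> w = 0"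
        using lin'[OF le[OF \<open>i \<le> n\<close>], unfolded m] by blast
      moreover have "v Th (s + j) \<in> span (v Th ` {s + i - i + 1..s + i})"
        using j by (intro span_base imageI) auto
      ultimately show "v Th (s + j) \<bullet> (linear_residual Th (s + i) -
          (\<Sum>l=1..i. am_Gamma Th (s + i) l *\<^sub>R am_q Th (s + l))) = 0"
        by (simp add: inner_commute)
    qed (use tri \<open>i \<le> n\<close> in auto)
  qed
qed

text \<open>Applied to a run and itself, \<open>comparable_cycle\<close> states that all quantities of the cycle are of their
  natural order in \<open>\<delta>\<close>; in particular the next iterate has a distance of order \<open>\<delta>\<close> to \<open>x\<^sup>*\<close>, although it is
  not yet known to lie in the ball.\<close>

lemma one_step:
  "\<exists>e>0. \<exists>C>0. \<forall>b T k. admissible b T k \<longrightarrow> am_m T k = n \<longrightarrow> (\<forall>j\<le>k. am_x T j \<in> cball xs \<rho>) \<longrightarrow>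
     norm (am_x T (k - n) - xs) \<le> e \<longrightarrow> norm (am_x T (k + 1) - xs) \<le> C * norm (am_x T (k - n) - xs)"
proof -
  define V where "V = {(b, T, k). admissible b T k \<and> am_m T k = n \<and> (\<forall>j\<le>k. am_x T j \<in> cball xs \<rho>)}"
  define b where "b = (\<lambda>(b :: nat \<Rightarrow> real, T :: (real ^ 'd) am_run, k :: nat). b)"
  define T where "T = (\<lambda>(b :: nat \<Rightarrow> real, T :: (real ^ 'd) am_run, k :: nat). T)"
  define s where "s = (\<lambda>(b :: nat \<Rightarrow> real, T :: (real ^ 'd) am_run, k). k - n)"
  define \<delta> where "\<delta> c = norm (am_x (T c) (s c) - xs)" for c
  define F where "F = vanishing_on \<delta> V"
  have V: "admissible (b c) (T c) (s c + n)" "am_m (T c) (s c + n) = n"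
    "j \<le> s c + n \<Longrightarrow> am_x (T c) j \<in> cball xs \<rho>" if "c \<in> V" for c j
  proof -
    obtain b' T' k where c: "c = (b', T', k)" by (cases c)
    have "n \<le> k" using that cycle_index[of b' T' k k] by (auto simp: V_def c)
    then show "admissible (b c) (T c) (s c + n)" "am_m (T c) (s c + n) = n"
      "j \<le> s c + n \<Longrightarrow> am_x (T c) j \<in> cball xs \<rho>"
      using that by (auto simp: V_def c b_def T_def s_def)
  qed
  have inV: "eventually (\<lambda>c. c \<in> V) F"
    unfolding F_def by (rule eventually_vanishing_onI)
  interpret small_parameter F \<delta>
  proof
    show "eventually (\<lambda>c. 0 < \<delta> c) F"
      unfolding F_def using iteration(4)[OF V(1) le_add1] by (intro eventually_vanishing_onI) (simp add: \<delta>_def)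
    show "(\<delta> \<longlongrightarrow> 0) F" unfolding F_def by (rule tendsto_vanishing_on)
  qed
  have start: "comparable 1 (\<lambda>c. am_x (T c) (s c) - xs) (\<lambda>c. am_x (T c) (s c) - xs)"
    by (rule comparableI[where C = 1], rule eventually_mono[OF positive]) (auto simp: \<delta>_def)
  have residual: "comparable 1 (\<lambda>c. residual (T c) (s c + i)) (\<lambda>c. residual (T c) (s c + i))"
    if "i \<le> n" and x: "comparable 1 (\<lambda>c. am_x (T c) (s c + i) - xs) (\<lambda>c. am_x (T c) (s c + i) - xs)" for i
  proof -
    obtain C where C: "eventually (\<lambda>c. norm (am_x (T c) (s c + i) - xs) \<le> C * \<delta> c ^ 1 \<and>
        norm (am_x (T c) (s c + i) - xs - (am_x (T c) (s c + i) - xs)) \<le> C * \<delta> c ^ Suc 1) F"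
      using x by (rule comparableE)
    have ball: "eventually (\<lambda>c. am_x (T c) (s c + i) \<in> cball xs \<rho>) F"
      unfolding F_def using V(3) that(1) by (intro eventually_vanishing_onI) simp
    have "eventually (\<lambda>c. norm (residual (T c) (s c + i)) \<le> (L * C) * \<delta> c ^ 1 \<and>
        norm (residual (T c) (s c + i) - residual (T c) (s c + i)) \<le> (L * C) * \<delta> c ^ Suc 1) F"
      using C ball
    proof eventually_elim
      case (elim c)
      have "norm (residual (T c) (s c + i)) \<le> L * norm (am_x (T c) (s c + i) - xs)"
        using h_upper elim by (simp add: residual_eq)
      also have "\<dots> \<le> L * (C * \<delta> c ^ 1)" using elim pos by (intro mult_left_mono) auto
      finally show ?case using elim pos by (auto simp: mult.assoc)
    qed
    then show ?thesis by (rule comparableI)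
  qed
  have den: "eventually (\<lambda>c. \<forall>j\<in>{1..n}. den_const * (\<delta> c)\<^sup>2 \<le> \<bar>v (T c) (s c + j) \<bullet> am_q (T c) (s c + j)\<bar>) F"
    unfolding F_def
  proof (rule eventually_vanishing_onI, rule ballI)
    fix c j assume c: "c \<in> V" and j: "j \<in> {1..n}"
    show "den_const * (\<delta> c)\<^sup>2 \<le> \<bar>v (T c) (s c + j) \<bullet> am_q (T c) (s c + j)\<bar>"
      unfolding \<delta>_def
      by (rule denominator_bound[OF V(1)[OF c] order_refl _ _ V(3)[OF c] j]) (simp_all add: V(2)[OF c])
  qed
  have cycle: "eventually (\<lambda>c. mixing_cycle tp (b c) (residual (T c)) (T c) (s c) n) F"
    using den positive inV
  proof eventually_elim
    case (elim c)
    have "v (T c) (s c + j) \<bullet> am_q (T c) (s c + j) \<noteq> 0" if "j \<in> {1..n}" for j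
    proof -
      have "0 < den_const * (\<delta> c)\<^sup>2" using den_const_pos elim by simp
      then show ?thesis using elim that by fastforce
    qed
    then show ?case
      using V(1,2)[of c] elim by (intro restarted_cycle[OF V(1) order_refl]) auto
  qed
  have b: "eventually (\<lambda>c. \<forall>j. \<bar>b c j\<bar> \<le> \<beta>') F"
    unfolding F_def using V(1) by (intro eventually_vanishing_onI) (auto simp: admissible_def)
  note cyc = comparable_cycle[OF cycle cycle b start residual den_const_pos den order_refl]
  have x: "comparable 1 (\<lambda>c. am_x (T c) (s c + n) - xs) (\<lambda>c. am_x (T c) (s c + n) - xs)"
    by (rule cyc(1))
  have r: "comparable 1 (\<lambda>c. residual (T c) (s c + n)) (\<lambda>c. residual (T c) (s c + n))"
    by (rule cyc(2))
  have p: "comparable 1 (\<lambda>c. am_p (T c) (s c + j)) (\<lambda>c. am_p (T c) (s c + j))" if "j \<in> {1..n}" for j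
    by (rule cyc(3)[OF _ _ that])
  have q: "comparable 1 (\<lambda>c. am_q (T c) (s c + j)) (\<lambda>c. am_q (T c) (s c + j))" if "j \<in> {1..n}" for j
    by (rule cyc(4)[OF _ _ that])
  have G: "comparable 0 (\<lambda>c. am_Gamma (T c) (s c + n) j) (\<lambda>c. am_Gamma (T c) (s c + n) j)" if "j \<in> {1..n}" for j
    by (rule cyc(5)[OF _ _ that])
  have bs: "comparable 0 (\<lambda>c. b c (s c + n)) (\<lambda>c. b c (s c + n))"
    by (rule comparable_bounded[where B = \<beta>']) (use b in eventually_elim, simp)
  have "comparable 1
      (\<lambda>c. ((am_x (T c) (s c + n) - xs) - (\<Sum>j=1..n. am_Gamma (T c) (s c + n) j *\<^sub>R am_p (T c) (s c + j))) +
        b c (s c + n) *\<^sub>R (residual (T c) (s c + n) - (\<Sum>j=1..n. am_Gamma (T c) (s c + n) j *\<^sub>R am_q (T c) (s c + j))))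
      (\<lambda>c. ((am_x (T c) (s c + n) - xs) - (\<Sum>j=1..n. am_Gamma (T c) (s c + n) j *\<^sub>R am_p (T c) (s c + j))) +
        b c (s c + n) *\<^sub>R (residual (T c) (s c + n) - (\<Sum>j=1..n. am_Gamma (T c) (s c + n) j *\<^sub>R am_q (T c) (s c + j))))"
    by (intro comparable_add comparable_diff comparable_sum comparable_scaleR bs x r p q G)
  then obtain C where "0 < C" and C: "eventually (\<lambda>c.
      norm (((am_x (T c) (s c + n) - xs) - (\<Sum>j=1..n. am_Gamma (T c) (s c + n) j *\<^sub>R am_p (T c) (s c + j))) +
        b c (s c + n) *\<^sub>R (residual (T c) (s c + n) - (\<Sum>j=1..n. am_Gamma (T c) (s c + n) j *\<^sub>R am_q (T c) (s c + j))))
      \<le> C * \<delta> c ^ 1) F"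
    by (rule comparableE) (auto elim: eventually_mono)
  from C inV have "eventually (\<lambda>c. norm (am_x (T c) (s c + n + 1) - xs) \<le> C * \<delta> c) F"
  proof eventually_elim
    case (elim c)
    have "am_x (T c) (s c + n + 1) - xs =
        ((am_x (T c) (s c + n) - xs) - (\<Sum>j=1..n. am_Gamma (T c) (s c + n) j *\<^sub>R am_p (T c) (s c + j))) +
        b c (s c + n) *\<^sub>R (residual (T c) (s c + n) - (\<Sum>j=1..n. am_Gamma (T c) (s c + n) j *\<^sub>R am_q (T c) (s c + j)))"
      using iteration(3)[OF V(1) order_refl, of c] elim by (simp add: V(2))
    from this elim(1) show ?case by (simp only: power_one_right)
  qed
  then obtain e where "0 < e" and e: "\<And>c. c \<in> V \<Longrightarrow> \<bar>\<delta> c\<bar> \<le> e \<Longrightarrow> norm (am_x (T c) (s c + n + 1) - xs) \<le> C * \<delta> c"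
    unfolding F_def eventually_vanishing_on by blast
  show ?thesis
  proof (intro exI conjI allI impI)
    fix b' T' k
    assume *: "admissible b' T' k" "am_m T' k = n" "\<forall>j\<le>k. am_x T' j \<in> cball xs \<rho>" "norm (am_x T' (k - n) - xs) \<le> e"
    have "n \<le> k" using cycle_index[OF *(1) order_refl] *(2) by simp
    then show "norm (am_x T' (k + 1) - xs) \<le> C * norm (am_x T' (k - n) - xs)"
      using e[of "(b', T', k)"] * by (simp add: V_def \<delta>_def T_def s_def)
  qed (fact \<open>0 < e\<close> \<open>0 < C\<close>)+
qed

section \<open>Uniform bounds over all runs\<close>

lemma admissible_mono: "admissible b T K \<Longrightarrow> k \<le> K \<Longrightarrow> admissible b T k"
  by (auto simp: admissible_def restarted_AM_def)

text \<open>If all iterates so far are within \<open>R\<close> times the initial error, then \<open>one_step\<close> puts the next one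
  into the ball. There \<open>h\<close> bounds the distance to \<open>x\<^sup>*\<close> from above, and the hypothesis on \<open>h(x\<^sub>j)\<close> brings
  the distance back to \<open>R\<close> times the initial error, with the same \<open>R\<close>.\<close>

lemma iterates_stay_near:
  assumes "0 < \<eta>0"
  shows "\<exists>e>0. \<exists>R>0. \<forall>b T K. admissible b T K \<longrightarrow>
      (\<forall>j\<le>K. norm (h (am_x T j)) \<le> \<eta>0 * norm (h (am_x T 0))) \<longrightarrow> norm (am_x T 0 - xs) \<le> e \<longrightarrow>
      (\<forall>j\<le>K. am_x T j \<in> cball xs \<rho> \<and> norm (am_x T j - xs) \<le> R * norm (am_x T 0 - xs))"
proof -
  define P where "P n e C \<longleftrightarrow> (\<forall>b T k. admissible b T k \<longrightarrow> am_m T k = n \<longrightarrow> (\<forall>j\<le>k. am_x T j \<in> cball xs \<rho>) \<longrightarrow>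
     norm (am_x T (k - n) - xs) \<le> e \<longrightarrow> norm (am_x T (k + 1) - xs) \<le> C * norm (am_x T (k - n) - xs))" for n e C
  have "\<exists>e>0. \<exists>C>0. \<forall>n\<le>m. P n e C"
  proof (rule uniform_over_finite_range)
    show "\<exists>e>0. \<exists>C>0. P n e C" for n unfolding P_def by (rule one_step)
    show "P n e' C'" if P: "P n e C" and "e' \<le> e" "C \<le> C'" for n e C e' C'
      unfolding P_def
    proof (intro allI impI)
      fix b T k
      assume *: "admissible b T k" "am_m T k = n" "\<forall>j\<le>k. am_x T j \<in> cball xs \<rho>" "norm (am_x T (k - n) - xs) \<le> e'"
      have "norm (am_x T (k - n) - xs) \<le> e" using *(4) \<open>e' \<le> e\<close> by simp
      with P * have "norm (am_x T (k + 1) - xs) \<le> C * norm (am_x T (k - n) - xs)"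
        unfolding P_def by blast
      also have "\<dots> \<le> C' * norm (am_x T (k - n) - xs)"
        using \<open>C \<le> C'\<close> by (intro mult_right_mono) auto
      finally show "norm (am_x T (k + 1) - xs) \<le> C' * norm (am_x T (k - n) - xs)" .
    qed
  qed
  then obtain e1 C where "0 < e1" "0 < C" and P: "\<And>n. n \<le> m \<Longrightarrow> P n e1 C" by blast
  \<comment> \<open>\<open>\<eta>0 * L / \<mu>\<close> compares the distances of \<open>x\<^sub>j\<close> and \<open>x\<^sub>0\<close> through \<open>h\<close>; the 1 covers \<open>x\<^sub>0\<close> itself.\<close>
  define R where "R = max 1 (\<eta>0 * L / \<mu>)"
  define e where "e = min \<rho> (min e1 (\<rho> / C)) / R"
  have R: "1 \<le> R" "\<eta>0 * L / \<mu> \<le> R" by (auto simp: R_def)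
  have "0 < e" using R pos \<open>0 < e1\<close> \<open>0 < C\<close> by (simp add: e_def)
  have Re: "R * e = min \<rho> (min e1 (\<rho> / C))" using R by (simp add: e_def)
  have "am_x T j \<in> cball xs \<rho> \<and> norm (am_x T j - xs) \<le> R * norm (am_x T 0 - xs)"
    if adm: "admissible b T K" and h: "\<forall>j\<le>K. norm (h (am_x T j)) \<le> \<eta>0 * norm (h (am_x T 0))"
      and start: "norm (am_x T 0 - xs) \<le> e" and "j \<le> K" for b T K j
    using \<open>j \<le> K\<close>
  proof (induction j rule: less_induct)
    case (less j)
    have Rx0: "R * norm (am_x T 0 - xs) \<le> R * e" using start R by (intro mult_left_mono) auto
    have x0: "norm (am_x T 0 - xs) \<le> R * norm (am_x T 0 - xs)"
      using R mult_right_mono[of 1 R "norm (am_x T 0 - xs)"] by simp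
    have ball: "x \<in> cball xs \<rho>" if "norm (x - xs) \<le> R * e" for x
      using that unfolding Re by (simp add: dist_norm norm_minus_commute)
    show ?case
    proof (cases j)
      case 0
      then show ?thesis using x0 Rx0 ball by auto
    next
      case (Suc k)
      define n where "n = am_m T k"
      have k: "k < j" "k \<le> K" using Suc less.prems by auto
      have n: "n \<le> m" using cycle_index[OF adm k(2)] by (simp add: n_def)
      have IH: "am_x T i \<in> cball xs \<rho>" "norm (am_x T i - xs) \<le> R * norm (am_x T 0 - xs)" if "i \<le> k" for i
        using less.IH[of i] that k by auto
      have near: "norm (am_x T (k - n) - xs) \<le> R * e"
        using IH(2)[of "k - n"] Rx0 by simp
      have "norm (am_x T j - xs) \<le> C * norm (am_x T (k - n) - xs)"
        using P[OF n, unfolded P_def, rule_format, of b T k] admissible_mono[OF adm k(2)] IH(1) near Suc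
        by (simp add: n_def Re)
      also have "\<dots> \<le> C * (\<rho> / C)"
        using near \<open>0 < C\<close> unfolding Re by (intro mult_left_mono) auto
      finally have "norm (am_x T j - xs) \<le> \<rho>" using \<open>0 < C\<close> by simp
      then have ball_j: "am_x T j \<in> cball xs \<rho>" by (simp add: dist_norm norm_minus_commute)
      have "\<mu> * norm (am_x T j - xs) \<le> norm (h (am_x T j))" by (rule h_lower[OF ball_j])
      also have "\<dots> \<le> \<eta>0 * norm (h (am_x T 0))" using h less.prems by blast
      also have "\<dots> \<le> \<eta>0 * (L * norm (am_x T 0 - xs))"
        using IH(1)[of 0] \<open>0 < \<eta>0\<close> by (intro mult_left_mono h_upper) auto
      finally have "norm (am_x T j - xs) \<le> (\<eta>0 * L / \<mu>) * norm (am_x T 0 - xs)"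
        using pos by (simp add: field_simps)
      also have "\<dots> \<le> R * norm (am_x T 0 - xs)"
        using R by (intro mult_right_mono) auto
      finally show ?thesis using ball_j by blast
    qed
  qed
  moreover have "0 < R" using R by linarith
  ultimately show ?thesis using \<open>0 < e\<close> by blast
qed

text \<open>The runs of both processes and the eigenvalue together form the index of the families, so that the resulting
  constant depends on none of them. By \<open>iterates_stay_near\<close> the error at the start of the cycle, which is the
  small parameter, tends to zero with the initial error. Only the length \<open>n\<close> of the cycle is fixed.\<close>

lemma hessenberg_perturbation:
  assumes "0 < \<eta>0" and "0 < \<tau>0" and "0 < n"
  shows "\<exists>e>0. \<exists>C>0. \<forall>b T Th k ev.
    norm (am_x T 0 - xs) \<le> e \<longrightarrow> admissible b T (k + 1) \<longrightarrow> linearized_AM tp A xs b T Th (k + 1) \<longrightarrow>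
    am_m T (k + 1) = n + 1 \<longrightarrow>
    (\<forall>j\<le>k + 1. norm (h (am_x T j)) \<le> \<eta>0 * norm (h (am_x T 0))) \<longrightarrow>
    (\<forall>j\<in>{1..k}. am_m T j \<ge> 1 \<longrightarrow> \<bar>1 - am_Gamma T j (am_m T j)\<bar> \<ge> \<tau>0) \<longrightarrow>
    ev \<in> complex_spectrum (hessenberg b T k) \<longrightarrow>
    Min ((\<lambda>z. cmod (z - ev)) ` complex_spectrum (hessenberg b Th k)) ^ n \<le> C * norm (am_x T (k - n) - xs) \<and>
    mat_norm2 (hessenberg b Th k - hessenberg b T k) \<le> C * norm (am_x T (k - n) - xs)"
proof -
  obtain e1 R where "0 < e1" "0 < R" and near: "\<And>b T K j. admissible b T K \<Longrightarrow>
      (\<forall>j\<le>K. norm (h (am_x T j)) \<le> \<eta>0 * norm (h (am_x T 0))) \<Longrightarrow> norm (am_x T 0 - xs) \<le> e1 \<Longrightarrow> j \<le> K \<Longrightarrow>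
      am_x T j \<in> cball xs \<rho> \<and> norm (am_x T j - xs) \<le> R * norm (am_x T 0 - xs)"
    using iterates_stay_near[OF \<open>0 < \<eta>0\<close>] by blast
  define b where "b = (\<lambda>(b :: nat \<Rightarrow> real, T :: (real ^ 'd) am_run, Th :: (real ^ 'd) am_run, s :: nat, ev :: complex). b)"
  define T where "T = (\<lambda>(b :: nat \<Rightarrow> real, T :: (real ^ 'd) am_run, Th :: (real ^ 'd) am_run, s :: nat, ev :: complex). T)"
  define Th where "Th = (\<lambda>(b :: nat \<Rightarrow> real, T :: (real ^ 'd) am_run, Th :: (real ^ 'd) am_run, s :: nat, ev :: complex). Th)"
  define s where "s = (\<lambda>(b :: nat \<Rightarrow> real, T :: (real ^ 'd) am_run, Th :: (real ^ 'd) am_run, s :: nat, ev :: complex). s)"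
  define ev where "ev = (\<lambda>(b :: nat \<Rightarrow> real, T :: (real ^ 'd) am_run, Th :: (real ^ 'd) am_run, s :: nat, ev :: complex). ev)"
  define a where "a c = norm (am_x (T c) 0 - xs)" for c
  define \<delta> where "\<delta> c = norm (am_x (T c) (s c) - xs)" for c
  define V where "V = {c.
    norm (am_x (T c) 0 - xs) \<le> e1 \<and> admissible (b c) (T c) (s c + n + 1) \<and>
    linearized_AM tp A xs (b c) (T c) (Th c) (s c + n + 1) \<and>
    am_m (T c) (s c + n + 1) = n + 1 \<and>
    (\<forall>j\<le>s c + n + 1. norm (h (am_x (T c) j)) \<le> \<eta>0 * norm (h (am_x (T c) 0))) \<and>
    (\<forall>j\<in>{1..s c + n}. am_m (T c) j \<ge> 1 \<longrightarrow> \<bar>1 - am_Gamma (T c) j (am_m (T c) j)\<bar> \<ge> \<tau>0) \<and>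
    ev c \<in> complex_spectrum (hessenberg (b c) (T c) (s c + n))}"
  define F where "F = vanishing_on a V"
  note sel = b_def T_def Th_def s_def ev_def
  have V: "norm (am_x (T c) 0 - xs) \<le> e1" "admissible (b c) (T c) (s c + n + 1)"
    "linearized_AM tp A xs (b c) (T c) (Th c) (s c + n + 1)"
    "am_m (T c) (s c + n + 1) = n + 1"
    "\<forall>j\<le>s c + n + 1. norm (h (am_x (T c) j)) \<le> \<eta>0 * norm (h (am_x (T c) 0))"
    "\<forall>j\<in>{1..s c + n}. am_m (T c) j \<ge> 1 \<longrightarrow> \<bar>1 - am_Gamma (T c) j (am_m (T c) j)\<bar> \<ge> \<tau>0"
    "ev c \<in> complex_spectrum (hessenberg (b c) (T c) (s c + n))" if "c \<in> V" for c
    using that unfolding V_def mem_Collect_eq by blast+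
  have m: "am_m (T c) (s c + i) = i" if "c \<in> V" "i \<le> n + 1" for c i
    using cycle_index[OF V(2)[OF that(1)] order_refl] V(4)[OF that(1)] that(2) by simp
  have ball: "am_x (T c) j \<in> cball xs \<rho>" "norm (am_x (T c) j - xs) \<le> R * a c" if "c \<in> V" "j \<le> s c + n + 1" for c j
    using near[OF V(2,5,1)[OF that(1)] that(2)] by (auto simp: a_def)
  have inV: "eventually (\<lambda>c. c \<in> V) F"
    unfolding F_def by (rule eventually_vanishing_onI)
  interpret small_parameter F \<delta>
  proof
    show "eventually (\<lambda>c. 0 < \<delta> c) F"
      using inV
    proof eventually_elim
      case (elim c)
      show ?case using iteration(4)[OF V(2)[OF elim], of "s c"] by (simp add: \<delta>_def)
    qed
    have "((\<lambda>c. R * a c) \<longlongrightarrow> R * 0) F"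
      unfolding F_def by (intro tendsto_mult_left tendsto_vanishing_on)
    then have lim: "((\<lambda>c. R * a c) \<longlongrightarrow> 0) F" by simp
    have "eventually (\<lambda>c. norm (\<delta> c) \<le> R * a c) F"
      using inV
    proof eventually_elim
      case (elim c)
      show ?case using ball(2)[OF elim, of "s c"] by (simp add: \<delta>_def)
    qed
    then show "(\<delta> \<longlongrightarrow> 0) F" using lim by (rule Lim_null_comparison)
  qed
  have start: "comparable 1 (\<lambda>c. am_x (T c) (s c) - xs) (\<lambda>c. am_x (Th c) (s c) - xs)"
  proof (rule comparableI[where C = 1])
    show "eventually (\<lambda>c. norm (am_x (T c) (s c) - xs) \<le> 1 * \<delta> c ^ 1 \<and>
        norm (am_x (T c) (s c) - xs - (am_x (Th c) (s c) - xs)) \<le> 1 * \<delta> c ^ Suc 1) F"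
      using inV
    proof eventually_elim
      case (elim c)
      have "am_x (Th c) (s c) = am_x (T c) (s c)"
        by (rule linearized_cycle(2)[OF V(2,3)[OF elim] order_refl V(4)[OF elim, symmetric]]) simp
      then show ?case by (simp add: \<delta>_def)
    qed
  qed
  have residuals: "comparable 1 (\<lambda>c. residual (T c) (s c + i)) (\<lambda>c. linear_residual (Th c) (s c + i))"
    if "i \<le> n + 1" and x: "comparable 1 (\<lambda>c. am_x (T c) (s c + i) - xs) (\<lambda>c. am_x (Th c) (s c + i) - xs)" for i
  proof -
    obtain C where "0 < C" and C: "eventually (\<lambda>c. norm (am_x (T c) (s c + i) - xs) \<le> C * \<delta> c ^ 1 \<and>
        norm (am_x (T c) (s c + i) - xs - (am_x (Th c) (s c + i) - xs)) \<le> C * \<delta> c ^ Suc 1) F"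
      using x by (rule comparableE)
    have "eventually (\<lambda>c. norm (residual (T c) (s c + i)) \<le> (L * C + \<kappa> / 2 * C\<^sup>2) * \<delta> c ^ 1 \<and>
        norm (residual (T c) (s c + i) - linear_residual (Th c) (s c + i)) \<le> (L * C + \<kappa> / 2 * C\<^sup>2) * \<delta> c ^ Suc 1) F"
      using C inV positive
    proof eventually_elim
      case (elim c)
      define x where "x = am_x (T c) (s c + i)"
      define y where "y = am_x (Th c) (s c + i)"
      have x: "x \<in> cball xs \<rho>" using ball(1)[OF elim(2), of "s c + i"] that(1) by (simp add: x_def)
      have xC: "norm (x - xs) \<le> C * \<delta> c" and xy: "norm (x - y) \<le> C * \<delta> c ^ Suc 1"
        using elim(1) by (simp_all add: x_def y_def)
      have "norm (h x) \<le> L * norm (x - xs)" by (rule h_upper[OF x])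
      also have "\<dots> \<le> L * (C * \<delta> c)" using xC pos by (intro mult_left_mono) auto
      also have "\<dots> \<le> (L * C + \<kappa> / 2 * C\<^sup>2) * \<delta> c ^ 1"
        using elim(3) pos by (simp add: algebra_simps)
      finally have 1: "norm (h x) \<le> (L * C + \<kappa> / 2 * C\<^sup>2) * \<delta> c ^ 1" .
      have "norm (h x - A *v (y - xs)) \<le> norm (h x - A *v (x - xs)) + norm (A *v (x - y))"
      proof -
        have "h x - A *v (y - xs) = (h x - A *v (x - xs)) + A *v (x - y)"
          by (simp add: matrix_vector_mult_diff_distrib)
        then show ?thesis by (simp only: norm_triangle_ineq)
      qed
      \<comment> \<open>the linearization error at \<open>x\<close>, and the deviation of the iterates under the Jacobian\<close>
      also have "\<dots> \<le> 1 / 2 * \<kappa> * (C * \<delta> c)\<^sup>2 + L * (C * \<delta> c ^ Suc 1)"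
      proof (rule add_mono)
        have "norm (h x - A *v (x - xs)) \<le> 1 / 2 * \<kappa> * (norm (x - xs))\<^sup>2" by (rule linearization_error[OF x])
        also have "\<dots> \<le> 1 / 2 * \<kappa> * (C * \<delta> c)\<^sup>2"
          using xC pos by (intro mult_left_mono power_mono) auto
        finally show "norm (h x - A *v (x - xs)) \<le> 1 / 2 * \<kappa> * (C * \<delta> c)\<^sup>2" .
        have "norm (A *v (x - y)) \<le> L * norm (x - y)" by (rule A_bound)
        also have "\<dots> \<le> L * (C * \<delta> c ^ Suc 1)" using xy pos by (intro mult_left_mono) auto
        finally show "norm (A *v (x - y)) \<le> L * (C * \<delta> c ^ Suc 1)" .
      qed
      also have "\<dots> = (L * C + \<kappa> / 2 * C\<^sup>2) * \<delta> c ^ Suc 1"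
        by (simp add: power2_eq_square algebra_simps)
      finally have 2: "norm (h x - A *v (y - xs)) \<le> (L * C + \<kappa> / 2 * C\<^sup>2) * \<delta> c ^ Suc 1" .
      have "residual (T c) (s c + i) - linear_residual (Th c) (s c + i) = - (h x - A *v (y - xs))"
        by (simp add: residual_eq linear_residual_def x_def y_def)
      then show ?case using 1 2 by (simp only: residual_eq norm_minus_cancel x_def simp_thms)
    qed
    then show ?thesis by (rule comparableI)
  qed
  have den: "eventually (\<lambda>c. \<forall>j\<in>{1..n + 1}. den_const * (\<delta> c)\<^sup>2 \<le> \<bar>v (T c) (s c + j) \<bullet> am_q (T c) (s c + j)\<bar>) F"
    using inV
  proof eventually_elim
    case (elim c)
    show ?case
      unfolding \<delta>_def
      by (rule ballI, rule denominator_bound[OF V(2)[OF elim] order_refl V(4)[OF elim, symmetric] _ ball(1)[OF elim]]) simp_all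
  qed
  have cycle: "eventually (\<lambda>c. mixing_cycle tp (b c) (residual (T c)) (T c) (s c) (n + 1)) F"
    using den positive inV
  proof eventually_elim
    case (elim c)
    have nz: "v (T c) (s c + j) \<bullet> am_q (T c) (s c + j) \<noteq> 0" if "j \<in> {1..n + 1}" for j
    proof -
      have "0 < den_const * (\<delta> c)\<^sup>2" using den_const_pos elim by simp
      then show ?thesis using elim that by fastforce
    qed
    show ?case
      by (rule restarted_cycle[OF V(2)[OF elim(3)] order_refl V(4)[OF elim(3), symmetric] _ nz]) simp_all
  qed
  have cycle': "eventually (\<lambda>c. mixing_cycle tp (b c) (linear_residual (Th c)) (Th c) (s c) (n + 1)) F"
    using inV
  proof eventually_elim
    case (elim c)
    show ?case
      by (rule linearized_cycle(1)[OF V(2,3)[OF elim] order_refl V(4)[OF elim, symmetric]]) simp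
  qed
  have b: "eventually (\<lambda>c. \<forall>j. \<bar>b c j\<bar> \<le> \<beta>') F" "eventually (\<lambda>c. \<forall>j. \<beta> \<le> \<bar>b c j\<bar>) F"
    using inV by (eventually_elim, use V(2) in \<open>auto simp: admissible_def\<close>)+
  note cyc = comparable_cycle[OF cycle cycle' b(1) start residuals den_const_pos den]
  have G: "comparable 0 (\<lambda>c. am_Gamma (T c) (s c + i) j) (\<lambda>c. am_Gamma (Th c) (s c + i) j)"
    if "i \<le> n" "j \<in> {1..i}" for i j
    by (rule cyc(5)[OF _ _ _ that(2)]) (use that(1) in auto)
  have Z: "comparable 0 (\<lambda>c. am_zeta (T c) (s c + Suc i) j) (\<lambda>c. am_zeta (Th c) (s c + Suc i) j)"
    if "i \<le> n" "j \<in> {1..i}" for i j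
    by (rule cyc(6)) (use that in auto)
  have \<tau>0: "eventually (\<lambda>c. \<tau>0 \<le> \<bar>1 - am_Gamma (T c) (s c + i) i\<bar>) F" if i: "i \<in> {1..n}" for i
    using inV
  proof eventually_elim
    case (elim c)
    have "s c + i \<in> {1..s c + n}" using i by auto
    then show ?case using V(6)[OF elim] m[OF elim, of i] i by fastforce
  qed
  define H where "H c = hess_rec (b c) (T c) (s c + n) n" for c
  define Hh where "Hh c = hess_rec (b c) (Th c) (s c + n) n" for c
  have hess: "hessenberg (b c) (T c) (s c + n) = H c" "hessenberg (b c) (Th c) (s c + n) = Hh c" if "c \<in> V" for c
  proof -
    have "am_m (Th c) = am_m (T c)" using V(3)[OF that] by (simp add: linearized_AM_def)
    then show "hessenberg (b c) (T c) (s c + n) = H c" "hessenberg (b c) (Th c) (s c + n) = Hh c"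
      using m[OF that, of n] by (simp_all add: hessenberg_def H_def Hh_def)
  qed
  have "\<exists>C>0. eventually (\<lambda>c.
      Min ((\<lambda>y. cmod (y - ev c)) ` complex_spectrum (Hh c)) ^ n \<le> C * \<delta> c \<and>
      mat_norm2 (Hh c - H c) \<le> C * \<delta> c) F"
  proof (rule comparable_spectrum[OF _ _ \<open>0 < n\<close>])
    show "H c \<in> carrier_mat n n" "Hh c \<in> carrier_mat n n" for c
      unfolding H_def Hh_def by (rule hess_rec_carrier)+
    show "comparable 0 (\<lambda>c. H c $$ (i, j)) (\<lambda>c. Hh c $$ (i, j))" if "i < n" "j < n" for i j
      unfolding H_def Hh_def
      by (rule comparable_hess_rec[OF \<beta>_pos b(2) G Z \<open>0 < \<tau>0\<close> \<tau>0 order_refl that])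
    show "eventually (\<lambda>c. ev c \<in> complex_spectrum (H c)) F"
      using inV by eventually_elim (use V(7) hess(1) in simp)
  qed
  then obtain C where "0 < C" and C: "eventually (\<lambda>c.
      Min ((\<lambda>y. cmod (y - ev c)) ` complex_spectrum (Hh c)) ^ n \<le> C * \<delta> c \<and>
      mat_norm2 (Hh c - H c) \<le> C * \<delta> c) F" by blast
  then obtain e2 where "0 < e2" and e2: "\<And>c. c \<in> V \<Longrightarrow> \<bar>a c\<bar> \<le> e2 \<Longrightarrow>
      Min ((\<lambda>y. cmod (y - ev c)) ` complex_spectrum (Hh c)) ^ n \<le> C * \<delta> c \<and>
      mat_norm2 (Hh c - H c) \<le> C * \<delta> c"
    unfolding F_def eventually_vanishing_on by blast
  show ?thesis
  proof (rule exI[of _ "min e1 e2"], intro exI[of _ C] conjI[of "0 < min e1 e2"] conjI[of "0 < C"] allI impI)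
    fix b' T' Th' k ev'
    assume *: "norm (am_x T' 0 - xs) \<le> min e1 e2" "admissible b' T' (k + 1)"
      "linearized_AM tp A xs b' T' Th' (k + 1)" "am_m T' (k + 1) = n + 1"
      "\<forall>j\<le>k + 1. norm (h (am_x T' j)) \<le> \<eta>0 * norm (h (am_x T' 0))"
      "\<forall>j\<in>{1..k}. am_m T' j \<ge> 1 \<longrightarrow> \<bar>1 - am_Gamma T' j (am_m T' j)\<bar> \<ge> \<tau>0"
      "ev' \<in> complex_spectrum (hessenberg b' T' k)"
    have "am_m T' (k + 1) \<le> k + 1" using cycle_index[OF *(2) order_refl] by blast
    then have k: "k - n + n = k" using *(4) by linarith
    define c where "c = (b', T', Th', k - n, ev')"
    have proj: "b c = b'" "T c = T'" "Th c = Th'" "s c = k - n" "ev c = ev'"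
      by (simp_all add: c_def sel)
    have start: "norm (am_x T' 0 - xs) \<le> e1" "norm (am_x T' 0 - xs) \<le> e2" using *(1) by auto
    have c: "c \<in> V" unfolding V_def mem_Collect_eq proj k using start(1) * by blast
    have "\<bar>a c\<bar> \<le> e2" using start(2) by (simp add: a_def proj)
    from e2[OF c this]
    show "Min ((\<lambda>z. cmod (z - ev')) ` complex_spectrum (hessenberg b' Th' k)) ^ n \<le> C * norm (am_x T' (k - n) - xs) \<and>
        mat_norm2 (hessenberg b' Th' k - hessenberg b' T' k) \<le> C * norm (am_x T' (k - n) - xs)"
      by (simp only: hess[OF c, symmetric] proj k \<delta>_def)
  qed (use \<open>0 < e1\<close> \<open>0 < e2\<close> \<open>0 < C\<close> in auto)
qed

end

section \<open>Perturbation of the eigenvalues\<close>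

lemma le_powr_of_power_le:
  fixes d y :: real
  assumes "0 \<le> d" and "0 < n" and "d ^ n \<le> y"
  shows "d \<le> y powr (1 / n)"
proof (cases "d = 0")
  case False
  then have "0 < d" using assms by simp
  then have "d = (d ^ n) powr (1 / n)"
    using \<open>0 < n\<close> by (simp add: powr_powr flip: powr_realpow)
  also have "\<dots> \<le> y powr (1 / n)" using assms by (intro powr_mono2) auto
  finally show ?thesis .
qed simp

theorem theorem5p6:
  fixes g h :: "real ^ 'd \<Rightarrow> real ^ 'd" and xs :: "real ^ 'd"
    and \<rho> \<kappa> \<mu> L \<tau> \<eta> \<beta> \<beta>' \<eta>0 \<tau>0 :: real
    and m :: nat and tp :: am_type
  assumes "\<And>x. h x = x - g x"
    and "assumption_H h xs"
    and "assumption_H_constants h xs \<rho> \<kappa> \<mu> L"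
    and "0 < m" and "m \<le> CARD('d)"
    and "0 < \<tau>" and "\<tau> < 1" and "0 < \<eta>"
    and "0 < \<beta>" and "0 < \<beta>'"
    and "0 < \<eta>0" and "0 < \<tau>0"
  shows "\<exists>\<epsilon>>0. \<exists>C>0.
    \<forall>(b :: nat \<Rightarrow> real) (T :: (real ^ 'd) am_run) (Th :: (real ^ 'd) am_run) (k :: nat) (ev :: complex).
      norm (am_x T 0 - xs) \<le> \<epsilon> \<and>
      (\<forall>j. \<beta> \<le> \<bar>b j\<bar> \<and> \<bar>b j\<bar> \<le> \<beta>') \<and>
      restarted_AM tp g m \<tau> \<eta> b T (k + 1) \<and>
      linearized_AM tp (jacobian h (at xs)) xs b T Th (k + 1) \<and>
      am_m T (k + 1) \<ge> 2 \<and>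
      (\<forall>j\<le>k + 1. norm (h (am_x T j)) \<le> \<eta>0 * norm (h (am_x T 0))) \<and>
      (\<forall>j\<in>{1..k}. am_m T j \<ge> 1 \<longrightarrow> \<bar>1 - am_Gamma T j (am_m T j)\<bar> \<ge> \<tau>0) \<and>
      ev \<in> complex_spectrum (hessenberg b T k)
      \<longrightarrow>
      Min ((\<lambda>z. cmod (z - ev)) ` complex_spectrum (hessenberg b Th k))
        \<le> \<kappa> powr (1 / am_m T k) * (C * norm (am_x T (k - am_m T k) - xs) powr (1 / am_m T k)) \<and>
      (\<forall>M Minv D. similar_mat_wit (hessenberg b Th k) D M Minv \<and> diagonal_mat D \<longrightarrow>
        Min ((\<lambda>z. cmod (z - ev)) ` complex_spectrum (hessenberg b Th k))
          \<le> mat_norm2 M * mat_norm2 Minv * \<kappa> * (C * norm (am_x T (k - am_m T k) - xs)))"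
proof -
  interpret mixing_problem g h xs \<rho> \<kappa> \<mu> L \<tau> \<eta> \<beta> \<beta>' m tp
    using assms by unfold_locales (auto simp: assumption_H_def)
  define P where "P n e C \<longleftrightarrow> (0 < n \<longrightarrow> (\<forall>b T Th k ev.
    norm (am_x T 0 - xs) \<le> e \<longrightarrow> admissible b T (k + 1) \<longrightarrow> linearized_AM tp A xs b T Th (k + 1) \<longrightarrow>
    am_m T (k + 1) = n + 1 \<longrightarrow>
    (\<forall>j\<le>k + 1. norm (h (am_x T j)) \<le> \<eta>0 * norm (h (am_x T 0))) \<longrightarrow>
    (\<forall>j\<in>{1..k}. am_m T j \<ge> 1 \<longrightarrow> \<bar>1 - am_Gamma T j (am_m T j)\<bar> \<ge> \<tau>0) \<longrightarrow>
    ev \<in> complex_spectrum (hessenberg b T k) \<longrightarrow>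
    Min ((\<lambda>z. cmod (z - ev)) ` complex_spectrum (hessenberg b Th k)) ^ n \<le> C * norm (am_x T (k - n) - xs) \<and>
    mat_norm2 (hessenberg b Th k - hessenberg b T k) \<le> C * norm (am_x T (k - n) - xs)))" for n e C
  have "\<exists>e>0. \<exists>C>0. \<forall>n\<le>m. P n e C"
  proof (rule uniform_over_finite_range)
    show "\<exists>e>0. \<exists>C>0. P n e C" for n
    proof (cases "n = 0")
      case True
      then show ?thesis by (auto simp: P_def intro: exI[of _ "1::real"])
    next
      case False
      then show ?thesis using hessenberg_perturbation[OF \<open>0 < \<eta>0\<close> \<open>0 < \<tau>0\<close>, of n] by (simp add: P_def)
    qed
    show "P n e' C'" if P: "P n e C" and "e' \<le> e" "C \<le> C'" for n e C e' C'
      unfolding P_def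
    proof (intro impI allI)
      fix b T Th k ev
      assume *: "0 < n" "norm (am_x T 0 - xs) \<le> e'" "admissible b T (k + 1)" "linearized_AM tp A xs b T Th (k + 1)"
        "am_m T (k + 1) = n + 1"
        "\<forall>j\<le>k + 1. norm (h (am_x T j)) \<le> \<eta>0 * norm (h (am_x T 0))"
        "\<forall>j\<in>{1..k}. am_m T j \<ge> 1 \<longrightarrow> \<bar>1 - am_Gamma T j (am_m T j)\<bar> \<ge> \<tau>0"
        "ev \<in> complex_spectrum (hessenberg b T k)"
      have "norm (am_x T 0 - xs) \<le> e" using *(2) \<open>e' \<le> e\<close> by simp
      note P[unfolded P_def, rule_format, OF *(1) this *(3-5) *(6)[rule_format] *(7)[rule_format] *(8)]
      moreover have "C * norm (am_x T (k - n) - xs) \<le> C' * norm (am_x T (k - n) - xs)"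
        using \<open>C \<le> C'\<close> by (intro mult_right_mono) auto
      ultimately show "Min ((\<lambda>z. cmod (z - ev)) ` complex_spectrum (hessenberg b Th k)) ^ n \<le> C' * norm (am_x T (k - n) - xs) \<and>
          mat_norm2 (hessenberg b Th k - hessenberg b T k) \<le> C' * norm (am_x T (k - n) - xs)"
        by linarith
    qed
  qed
  then obtain e C where "0 < e" "0 < C" and P: "\<And>n. n \<le> m \<Longrightarrow> P n e C" by blast
  \<comment> \<open>At least 1, so that its roots of any order are bounded by \<open>C'\<close> itself.\<close>
  define C' where "C' = max 1 (C / \<kappa>)"
  show ?thesis
  proof (rule exI[of _ e], intro exI[of _ C'] conjI[of "0 < e"] conjI[of "0 < C'"] allI impI, goal_cases)
    case 1
    then show ?case by (rule \<open>0 < e\<close>)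
  next
    case 2
    then show ?case by (simp add: C'_def)
  next
    case (3 b T Th k ev)
    define n where "n = am_m T k"
    define \<delta> where "\<delta> = norm (am_x T (k - n) - xs)"
    define d where "d = Min ((\<lambda>z. cmod (z - ev)) ` complex_spectrum (hessenberg b Th k))"
    have adm: "admissible b T (k + 1)" and lin: "linearized_AM tp A xs b T Th (k + 1)"
      using 3 by (auto simp: admissible_def A_def)
    have mk: "am_m T (k + 1) = n + 1" "0 < n" and "n \<le> m"
      using iteration(1)[OF adm order_refl] 3 cycle_index[OF adm, of k] by (auto simp: n_def)
    have bounds: "d ^ n \<le> C * \<delta>" "mat_norm2 (hessenberg b Th k - hessenberg b T k) \<le> C * \<delta>"
      using P[OF \<open>n \<le> m\<close>, unfolded P_def, rule_format, OF \<open>0 < n\<close> _ adm lin mk(1), of ev] 3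
      by (auto simp: d_def \<delta>_def)
    have carr: "hessenberg b T k \<in> carrier_mat n n" "hessenberg b Th k \<in> carrier_mat n n"
      using lin hess_rec_carrier by (auto simp: hessenberg_def n_def linearized_AM_def)
    have "0 \<le> d"
      using complex_spectrum_finite_nonempty[OF carr(2) \<open>0 < n\<close>] by (simp add: d_def)
    have "0 \<le> \<delta>" by (simp add: \<delta>_def)
    have C: "C \<le> \<kappa> * C'" using pos(2) by (simp add: C'_def max_def field_simps)
    have "d \<le> (C * \<delta>) powr (1 / n)"
      using le_powr_of_power_le[OF \<open>0 \<le> d\<close> \<open>0 < n\<close> bounds(1)] .
    also have "\<dots> \<le> (\<kappa> * (C' * \<delta>)) powr (1 / n)"
      using C \<open>0 < C\<close> \<open>0 \<le> \<delta>\<close> mult_right_mono[OF C \<open>0 \<le> \<delta>\<close>] by (intro powr_mono2) (auto simp: mult.assoc)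
    also have "\<dots> = \<kappa> powr (1 / n) * (C' powr (1 / n) * \<delta> powr (1 / n))"
      using pos(2) \<open>0 \<le> \<delta>\<close> by (simp add: powr_mult C'_def)
    also have "\<dots> \<le> \<kappa> powr (1 / n) * (C' * \<delta> powr (1 / n))"
    proof (intro mult_left_mono mult_right_mono)
      have "C' powr (1 / n) \<le> C' powr 1"
        using \<open>0 < n\<close> by (intro powr_mono) (auto simp: C'_def)
      then show "C' powr (1 / n) \<le> C'" by (simp add: C'_def)
    qed auto
    finally have 1: "d \<le> \<kappa> powr (1 / n) * (C' * \<delta> powr (1 / n))" .
    have 2: "d \<le> mat_norm2 M * mat_norm2 Minv * \<kappa> * (C' * \<delta>)"
      if sim: "similar_mat_wit (hessenberg b Th k) D M Minv" and diag: "diagonal_mat D" for M Minv D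
    proof -
      have MM: "M \<in> carrier_mat n n" "Minv \<in> carrier_mat n n"
        using sim carr by (auto simp: similar_mat_wit_def Let_def)
      have "d \<le> mat_norm2 M * mat_norm2 Minv * mat_norm2 (hessenberg b Th k - hessenberg b T k)"
        unfolding d_def using 3 by (intro bauer_fike[OF carr \<open>0 < n\<close> sim diag]) blast
      also have "\<dots> \<le> mat_norm2 M * mat_norm2 Minv * (\<kappa> * C' * \<delta>)"
        using bounds(2) mult_right_mono[OF C \<open>0 \<le> \<delta>\<close>] mat_norm2_nonneg[OF _ \<open>0 < n\<close>] MM
        by (intro mult_left_mono mult_nonneg_nonneg) auto
      finally show ?thesis by (simp add: mult.assoc)
    qed
    show ?case
      using 1 2 unfolding d_def \<delta>_def n_def by blast
  qed
qed

end
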